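(* Let $d\in\{2,3\}$, $0\le\alpha\le 1$, $\beta>0$, $\gamma>0$. For $\ell=1,\dots,d$ let $a_\ell:[0,1]\to\mathbb{R}$ be a coefficient function, and let $a_\ell^-,a_\ell^+:[0,1]\to(0,\infty)$ be a minorant and a majorant of it, i.e. $0<a_\ell^-(x)\le a_\ell(x)\le a_\ell^+(x)$ for all $x\in[0,1]$, such that $\min_{x} a_\ell^-(x)>0$ and $\max_x a_\ell^+(x)<\infty$ exist. Put $$b_0^\ell=\tfrac12\Big(\max_{x\in[0,1]}a_\ell^+(x)+\min_{x\in[0,1]}a_\ell^-(x)\Big),\qquad \ell=1,\dots,d.$$ For grid sizes $\mathbf n=(n_1,\dots,n_d)$, $n_\ell\ge 2$, let $A=A_{\mathbf n}$ be the finite difference stiffness matrix (defined in the context) of the operator $-\sum_{\ell=1}^d\frac{\partial}{\partial x_\ell}a_\ell(x_\ell)\frac{\partial}{\partial x_\ell}$ on $(0,1)^d$, and let $B=B_{\mathbf n}$ be the stiffness matrix of the anisotropic Laplacian $-\sum_{\ell=1}^d\frac{\partial}{\partial x_\ell}b_0^\ell\frac{\partial}{\partial x_\ell}$, obtained by the same scheme with each $a_\ell$ replaced by the constant $b_0^\ell$. Set $$\mathcal F_2(A)=\beta A^{-\alpha}+\tfrac{\gamma}{\beta}A^{\alpha},\qquad B_0=\beta B^{-\alpha}+\tfrac{\gamma}{\beta}B^{\alpha}.$$ Then the condition number of the preconditioned matrix $B_0^{-1}\mathcal F_2(A)$ is bounded uniformly in the grid size. Specifically, there exist constants $C>0$ and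 $0<q<1$, both independent of $\mathbf n$, such that for all $\mathbf n$ $$\operatorname{cond}\{B_0^{-1}\mathcal F_2(A)\}\le C\,\frac{\max\{(1+q)^\alpha,(1-q)^{-\alpha}\}}{\min\{(1+q)^{-\alpha},(1-q)^{\alpha}\}}.$$
   Context: Finite difference scheme. For each $\ell$ and $n_\ell\ge2$, let $h_\ell=1/(n_\ell+1)$ and take the uniform grid points $x_i=i h_\ell$, $i=1,\dots,n_\ell$, in $(0,1)$. Write $a_{i\pm\frac12}$ for the value of $a_\ell$ at the midpoint between $x_i$ and $x_{i\pm1}$. The one-dimensional matrix $A_{(\ell)}\in\mathbb{R}^{n_\ell\times n_\ell}$ is the symmetric tridiagonal matrix $A_{(\ell)}=-\frac{1}{h_\ell^2}[a_{i,j}]$ (discretizing $-\frac{d}{dx_\ell}a_\ell\frac{d}{dx_\ell}$ with homogeneous Dirichlet conditions), with - $a_{i,i+1}=a_{i+\frac12}$ and $a_{i,i-1}=a_{i-\frac12}$; - $a_{i,i}=-a_{i+\frac12}-a_{i-\frac12}$ for $1<i<n_\ell$; - $a_{1,1}=-2a_{1+\frac12}$ and $a_{n_\ell,n_\ell}=-2a_{n_\ell-\frac12}$; - all other entries equal to zero. The $d$-dimensional stiffness matrix is the Kronecker sum of the $A_{(\ell)}$. For $d=2$, $A=A_{(1)}\otimes I_2+I_1\otimes A_{(2)}$. For $d=3$, $A=A_{(1)}\otimes I_2\otimes I_3+I_1\otimes A_{(2)}\otimes I_3+I_1\otimes I_2\otimes A_{(3)}$. Here $\otimes$ is the Kronecker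 product and $I_\ell$ is the $n_\ell\times n_\ell$ identity matrix. The matrices $A$ and $B$ are symmetric positive definite. Fractional powers $A^{\pm\alpha}$, $B^{\pm\alpha}$ are defined through the spectral decomposition: if $A=Q^T\operatorname{diag}(\lambda_i)Q$ with $Q$ orthogonal, then $A^{s}=Q^T\operatorname{diag}(\lambda_i^{s})Q$ for real $s$. For symmetric positive definite matrices $P,S$, the matrix $P^{-1}S$ has positive real eigenvalues, and $\operatorname{cond}\{P^{-1}S\}=\lambda_{\max}(P^{-1}S)/\lambda_{\min}(P^{-1}S)$ denotes its spectral condition number. *)

theory Defs
  imports
    "Jordan_Normal_Form.Spectral_Radius"
    "Jordan_Normal_Form.Gauss_Jordan_Elimination"
begin

text \<open>The indices $i, j$ run from $1$ to $n$, and the midpoint between the grid points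
  $x_i = i h$ and $x_{i \pm 1}$ is $(i \pm 1/2) h$.\<close>

definition fd_entry :: "(real \<Rightarrow> real) \<Rightarrow> nat \<Rightarrow> nat \<Rightarrow> nat \<Rightarrow> real" where
  "fd_entry a n i j =
    (let h = 1 / (real n + 1);
         a_plus = a ((real i + 1/2) * h);
         a_minus = a ((real i - 1/2) * h)
     in if j = i + 1 then a_plus
        else if i = j + 1 then a_minus
        else if i = j then
          (if i = 1 then - 2 * a_plus
           else if i = n then - 2 * a_minus
           else - a_plus - a_minus)
        else 0)"

text \<open>Entries of type \<open>mat\<close> are indexed from $0$, hence the shift.\<close>

definition fd_matrix :: "(real \<Rightarrow> real) \<Rightarrow> nat \<Rightarrow> real mat" where
  "fd_matrix a n =
    (let h = 1 / (real n + 1)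
     in (- (1 / h^2)) \<cdot>\<^sub>m mat n n (\<lambda>(i, j). fd_entry a n (Suc i) (Suc j)))"

definition kronecker :: "real mat \<Rightarrow> real mat \<Rightarrow> real mat" (infixl "\<otimes>\<^sub>K" 70) where
  "A \<otimes>\<^sub>K B = mat (dim_row A * dim_row B) (dim_col A * dim_col B)
    (\<lambda>(i, j). A $$ (i div dim_row B, j div dim_col B) * B $$ (i mod dim_row B, j mod dim_col B))"

text \<open>The coefficient functions \<open>a l\<close> and the grid sizes \<open>n l\<close> are indexed by
  $l = 1, \dots, d$; only $d = 2$ and $d = 3$ are meaningful.\<close>

definition stiffness :: "nat \<Rightarrow> (nat \<Rightarrow> real \<Rightarrow> real) \<Rightarrow> (nat \<Rightarrow> nat) \<Rightarrow> real mat" where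
  "stiffness d a n =
    (let A = (\<lambda>l. fd_matrix (a l) (n l)); I = (\<lambda>l. 1\<^sub>m (n l))
     in if d = 2 then A 1 \<otimes>\<^sub>K I 2 + I 1 \<otimes>\<^sub>K A 2
        else A 1 \<otimes>\<^sub>K I 2 \<otimes>\<^sub>K I 3 + I 1 \<otimes>\<^sub>K A 2 \<otimes>\<^sub>K I 3 + I 1 \<otimes>\<^sub>K I 2 \<otimes>\<^sub>K A 3)"

definition spectral_decomposition :: "real mat \<Rightarrow> real mat \<Rightarrow> (nat \<Rightarrow> real) \<Rightarrow> bool" where
  "spectral_decomposition A Q ev \<longleftrightarrow>
    (let N = dim_row A
     in Q \<in> carrier_mat N N \<and> transpose_mat Q * Q = 1\<^sub>m N \<and>
        A = transpose_mat Q * mat_diag N ev * Q)"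

text \<open>The power does not depend on the chosen spectral decomposition. It is intended for
  symmetric positive definite matrices: \<open>powr\<close> is the usual real power on positive
  eigenvalues.\<close>

definition mat_powr :: "real mat \<Rightarrow> real \<Rightarrow> real mat" where
  "mat_powr A s = (SOME M. \<exists>Q ev. spectral_decomposition A Q ev \<and>
    M = transpose_mat Q * mat_diag (dim_row A) (\<lambda>i. ev i powr s) * Q)"

definition F2 :: "real \<Rightarrow> real \<Rightarrow> real \<Rightarrow> real mat \<Rightarrow> real mat" where
  "F2 \<alpha> \<beta> \<gamma> A = \<beta> \<cdot>\<^sub>m mat_powr A (- \<alpha>) + (\<gamma> / \<beta>) \<cdot>\<^sub>m mat_powr A \<alpha>"

text \<open>Intended for matrices $P^{-1} S$ with $P$, $S$ symmetric positive definite, all of whose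
  eigenvalues are real and positive, so that the real spectrum is the whole spectrum.\<close>

definition spectral_cond :: "real mat \<Rightarrow> real" where
  "spectral_cond M = Max (spectrum M) / Min (spectrum M)"

end

theory Submission
  imports "HOL-Analysis.Equivalence_Lebesgue_Henstock_Integration" Defs
begin

text \<open>The bound holds with $C = 1$. The constant $b_0^\ell$ is the midpoint of an interval
  $[m_\ell, M_\ell] \subseteq (0, \infty)$ that contains all values of $a_\ell$, so
  $(1 - q)\, b_0^\ell \le a_\ell \le (1 + q)\, b_0^\ell$ for one number $q < 1$. The quadratic form
  of a stiffness matrix is a discrete Dirichlet energy, a sum of squares whose coefficients are
  values of the $a_\ell$. It is therefore monotone and linear in the coefficient functions, and the
  pointwise inequality becomes $(1 - q) B \le A \le (1 + q) B$ in the order of quadratic forms, on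
  every grid (lemmas \<open>qform_stiffness\<close>, \<open>stiffness_energy_mono\<close>, \<open>stiffness_energy_scale\<close>).

  The matrices $A$ and $B$ need not commute, so passing to fractional powers needs the
  Loewner--Heinz inequality: $A \le c B$ implies $A^\alpha \le c^\alpha B^\alpha$ and
  $B^{-\alpha} \le c^\alpha A^{-\alpha}$ for $0 \le \alpha \le 1$ (\<open>loewner_heinz\<close>,
  \<open>loewner_heinz_negative\<close>). It is obtained from the resolvents: $x^T (I + t A)^{-1} x$ is the
  maximum over $y$ of $2 x^T y - y^T y - t\, y^T A y$, hence antitone in $A$, and
  $\lambda^{-s}$ is a positive multiple of $\int_{-\infty}^\infty e^{su} / (1 + e^u \lambda)\, du$
  for $0 < s < 1$, so negative powers are positive mixtures of resolvents.

  Applied to both inequalities, Loewner--Heinz bounds the form of $\mathcal F_2(A)$ from both sides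
  by multiples of the form of $B_0$, and these multiples enclose the spectrum of
  $B_0^{-1} \mathcal F_2(A)$ (\<open>spectral_cond_le\<close>).\<close>

section \<open>Quadratic forms and positive definite matrices\<close>

text \<open>Vectors enter as functions on indices, of which only the values below the dimension matter.
  Reindexing a vector along a Kronecker product is then mere composition.\<close>

definition bform :: "real mat \<Rightarrow> (nat \<Rightarrow> real) \<Rightarrow> (nat \<Rightarrow> real) \<Rightarrow> real" where
  "bform M x y = (\<Sum>i<dim_row M. \<Sum>j<dim_col M. x i * (M $$ (i, j) * y j))"

abbreviation qform :: "real mat \<Rightarrow> (nat \<Rightarrow> real) \<Rightarrow> real" where
  "qform M x \<equiv> bform M x x"

definition pos_def :: "nat \<Rightarrow> real mat \<Rightarrow> bool" where
  "pos_def n M \<longleftrightarrow> M \<in> carrier_mat n n \<and> transpose_mat M = M \<and>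
    (\<forall>x. (\<exists>i<n. x i \<noteq> 0) \<longrightarrow> 0 < qform M x)"

lemma bform_commute:
  assumes "transpose_mat M = M"
  shows "bform M x y = bform M y x"
proof -
  have "M $$ (i, j) = M $$ (j, i)" if "i < dim_row M" "j < dim_col M" for i j
    using that assms by (metis index_transpose_mat(1,2))
  moreover have "dim_col M = dim_row M" using assms by (metis index_transpose_mat(2))
  ultimately show ?thesis
    unfolding bform_def by (subst sum.swap) (auto intro!: sum.cong)
qed

lemma bform_add:
  assumes "M \<in> carrier_mat n n" "N \<in> carrier_mat n n"
  shows "bform (M + N) x y = bform M x y + bform N x y"
  using assms by (simp add: bform_def distrib_left distrib_right sum.distrib)

lemma bform_smult: "bform (c \<cdot>\<^sub>m M) x y = c * bform M x y"
  by (simp add: bform_def sum_distrib_left mult_ac)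

lemma bform_one: "bform (1\<^sub>m n) x y = (\<Sum>i<n. x i * y i)"
proof -
  have "(\<Sum>j<n. x i * (1\<^sub>m n $$ (i, j) * y j)) = (\<Sum>j<n. if j = i then x i * y i else 0)" if "i < n" for i
    using that by (intro sum.cong) auto
  then show ?thesis by (simp add: bform_def)
qed

lemma index_mult_mat_vec_sum:
  assumes "i < dim_row A" "v \<in> carrier_vec (dim_col A)"
  shows "(A *\<^sub>v v) $ i = (\<Sum>j<dim_col A. A $$ (i, j) * v $ j)"
  using assms by (auto simp: scalar_prod_def lessThan_atLeast0 intro!: sum.cong)

lemma bform_conv_mult_mat_vec:
  assumes "M \<in> carrier_mat n n" "v \<in> carrier_vec n"
  shows "bform M x (\<lambda>i. v $ i) = (\<Sum>i<n. x i * (M *\<^sub>v v) $ i)"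
  using assms by (auto simp: bform_def index_mult_mat_vec_sum sum_distrib_left
      simp del: index_mult_mat_vec intro!: sum.cong)

lemma pos_def_one: "pos_def n (1\<^sub>m n)"
  unfolding pos_def_def bform_one power2_eq_square[symmetric] by (auto intro!: sum_pos2)

lemma pos_def_nonsingular:
  assumes "pos_def n P"
  shows "det P \<noteq> 0"
proof
  assume "det P = 0"
  have P: "P \<in> carrier_mat n n" using assms by (simp add: pos_def_def)
  from \<open>det P = 0\<close> obtain v where v: "v \<in> carrier_vec n" "v \<noteq> 0\<^sub>v n" "P *\<^sub>v v = 0\<^sub>v n"
    using det_0_iff_vec_prod_zero_field[OF P] by auto
  have "qform P (\<lambda>i. v $ i) = 0"
    using bform_conv_mult_mat_vec[OF P v(1)] v(3) by simp
  moreover have "\<exists>i<n. v $ i \<noteq> 0" using v(1,2) by (auto simp: vec_eq_iff)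
  ultimately show False using assms unfolding pos_def_def by fastforce
qed

lemma pos_def_mat_inverse:
  assumes "pos_def n P"
  shows "the (mat_inverse P) \<in> carrier_mat n n"
    and "the (mat_inverse P) * P = 1\<^sub>m n" "P * the (mat_inverse P) = 1\<^sub>m n"
proof -
  have P: "P \<in> carrier_mat n n" using assms by (simp add: pos_def_def)
  have "mat_inverse P \<noteq> None"
    using mat_inverse(1)[OF P, of "()"] det_non_zero_imp_unit[OF P pos_def_nonsingular[OF assms], of "()"]
    by blast
  then obtain R where "mat_inverse P = Some R" by auto
  from mat_inverse(2)[OF P this] this
  show "the (mat_inverse P) \<in> carrier_mat n n"
    "the (mat_inverse P) * P = 1\<^sub>m n" "P * the (mat_inverse P) = 1\<^sub>m n" by auto
qed

text \<open>The generalized eigenproblem $F v = e P v$ has a complex solution, because $P^{-1} F$ has a complex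
  eigenvalue. As in the case $P = I$, symmetry makes the eigenvalue real, and then the real or the
  imaginary part of the eigenvector is a real solution. The case $P = I$ starts the
  diagonalization of symmetric matrices; the case $P = B_0$ shows that the real spectrum of the
  preconditioned matrix is nonempty, so that its maximum and minimum are meaningful.\<close>

lemma symmetric_pencil_eigenvector:
  assumes F: "F \<in> carrier_mat n n" "transpose_mat F = F" and P: "pos_def n P" and n: "0 < n"
  obtains e v where "v \<in> carrier_vec n" "v \<noteq> 0\<^sub>v n" "F *\<^sub>v v = e \<cdot>\<^sub>v (P *\<^sub>v v)"
proof -
  have Pc: "P \<in> carrier_mat n n" and Pt: "transpose_mat P = P" using P by (auto simp: pos_def_def)
  define R where "R = the (mat_inverse P)"
  have R: "R \<in> carrier_mat n n" "P * R = 1\<^sub>m n"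
    using pos_def_mat_inverse[OF P] by (auto simp: R_def)
  let ?c = "map_mat complex_of_real"
  have cR: "?c (R * F) \<in> carrier_mat n n" using R F by auto
  from spectrum_non_empty[OF this n] obtain \<mu> w where "eigenvector (?c (R * F)) w \<mu>"
    unfolding spectrum_def eigenvalue_def by auto
  then have w: "w \<in> carrier_vec n" "w \<noteq> 0\<^sub>v n" "?c (R * F) *\<^sub>v w = \<mu> \<cdot>\<^sub>v w"
    using cR by (auto simp: eigenvector_def)
  have "?c P *\<^sub>v (?c (R * F) *\<^sub>v w) = (?c P * ?c (R * F)) *\<^sub>v w"
    using Pc cR w by (intro assoc_mult_mat_vec[symmetric]) auto
  also have "?c P * ?c (R * F) = ?c (P * (R * F))"
    using R F by (intro of_real_hom.mat_hom_mult[OF Pc, symmetric]) auto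
  also have "P * (R * F) = F"
    using assoc_mult_mat[of P n n R n F n] Pc R F by simp
  finally have "?c F *\<^sub>v w = \<mu> \<cdot>\<^sub>v (?c P *\<^sub>v w)"
    using w Pc by (simp add: mult_mat_vec[of "?c P" n n])
  then have entry: "(\<Sum>j<n. of_real (F $$ (i, j)) * w $ j) = \<mu> * (\<Sum>j<n. of_real (P $$ (i, j)) * w $ j)"
    if "i < n" for i
    using that F Pc w(1) by (auto simp: vec_eq_iff index_mult_mat_vec_sum simp del: index_mult_mat_vec)
  define x y where "x = (\<lambda>i. Re (w $ i))" and "y = (\<lambda>i. Im (w $ i))"
  have re: "(\<Sum>j<n. F $$ (i, j) * x j) = Re \<mu> * (\<Sum>j<n. P $$ (i, j) * x j) - Im \<mu> * (\<Sum>j<n. P $$ (i, j) * y j)"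
    and im: "(\<Sum>j<n. F $$ (i, j) * y j) = Re \<mu> * (\<Sum>j<n. P $$ (i, j) * y j) + Im \<mu> * (\<Sum>j<n. P $$ (i, j) * x j)"
    if "i < n" for i
    using arg_cong[OF entry[OF that], of Re] arg_cong[OF entry[OF that], of Im]
    by (simp_all add: x_def y_def)
  have b: "bform M z u = (\<Sum>i<n. z i * (\<Sum>j<n. M $$ (i, j) * u j))" if "M \<in> carrier_mat n n" for M z u
    using that by (simp add: bform_def sum_distrib_left)
  \<comment> \<open>The real part of the equation is paired with the imaginary part of the eigenvector and conversely,
    so that symmetry identifies the two left-hand sides.\<close>
  have 1: "bform F y x = Re \<mu> * bform P y x - Im \<mu> * bform P y y"
    unfolding b[OF F(1)] b[OF Pc] using re
    by (simp add: sum_subtractf sum_distrib_left right_diff_distrib mult.left_commute)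
  have 2: "bform F x y = Re \<mu> * bform P x y + Im \<mu> * bform P x x"
    unfolding b[OF F(1)] b[OF Pc] using im
    by (simp add: sum.distrib sum_distrib_left distrib_left mult.left_commute)
  have nn: "0 \<le> bform P z z" for z
  proof (cases "\<exists>i<n. z i \<noteq> 0")
    case False
    then show ?thesis using b[OF Pc, of z z] by simp
  qed (use P in \<open>auto simp: pos_def_def less_imp_le\<close>)
  have nz: "(\<exists>i<n. x i \<noteq> 0) \<or> (\<exists>i<n. y i \<noteq> 0)"
    using w(1,2) by (auto simp: vec_eq_iff x_def y_def complex_eq_iff)
  then have "0 < bform P x x + bform P y y"
    using P nn[of x] nn[of y] unfolding pos_def_def by (meson add_pos_nonneg add_nonneg_pos)
  moreover have "Im \<mu> * (bform P x x + bform P y y) = 0"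
    using 1 2 bform_commute[OF F(2), of x y] bform_commute[OF Pt, of x y] by (simp add: algebra_simps)
  ultimately have "Im \<mu> = 0" by simp
  with nz re im obtain z where z: "\<exists>i<n. z i \<noteq> 0"
    "\<And>i. i < n \<Longrightarrow> (\<Sum>j<n. F $$ (i, j) * z j) = Re \<mu> * (\<Sum>j<n. P $$ (i, j) * z j)"
    by fastforce
  show thesis
  proof (rule that[of "vec n z" "Re \<mu>"])
    show "vec n z \<noteq> 0\<^sub>v n" using z(1) by (auto simp: vec_eq_iff)
    show "F *\<^sub>v vec n z = Re \<mu> \<cdot>\<^sub>v (P *\<^sub>v vec n z)"
      using z(2) F Pc by (auto simp: vec_eq_iff index_mult_mat_vec_sum simp del: index_mult_mat_vec)
  qed simp
qed

section \<open>Orthogonal diagonalization of symmetric matrices\<close>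

text \<open>Gram--Schmidt on a basis that starts with \<open>v\<close> keeps \<open>v\<close> as its first vector; normalizing the
  result gives the columns of \<open>W\<close>.\<close>

lemma orthogonal_completion:
  fixes v :: "real vec"
  assumes v: "v \<in> carrier_vec n" "v \<noteq> 0\<^sub>v n"
  obtains W c where "W \<in> carrier_mat n n" "transpose_mat W * W = 1\<^sub>m n" "col W 0 = c \<cdot>\<^sub>v v"
proof -
  interpret cof_vec_space n "TYPE(real)" .
  define ws where "ws = gram_schmidt n (basis_completion v)"
  note bc = basis_completion[OF v]
  have ws: "corthogonal ws" "set ws \<subseteq> carrier_vec n" "length ws = n"
    using gram_schmidt_result[OF bc(2,4,5) ws_def] bc(6) by auto
  have hd: "hd ws = v"
    using gram_schmidt_hd[OF v(1)] bc(7) unfolding ws_def basis_completion_def Let_def by auto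
  have n: "0 < n" using v by (cases n) auto
  have orth: "ws ! i \<bullet> ws ! j = 0 \<longleftrightarrow> i \<noteq> j" if "i < n" "j < n" for i j
    using corthogonalD[OF ws(1), of i j] that ws(3) by simp
  have carr: "ws ! i \<in> carrier_vec n" if "i < n" for i using ws that by auto
  define r where "r = (\<lambda>i. 1 / sqrt (ws ! i \<bullet> ws ! i))"
  have unit: "r i * r i * (ws ! i \<bullet> ws ! i) = 1" if "i < n" for i
  proof -
    have "0 \<le> ws ! i \<bullet> ws ! i" by (simp add: scalar_prod_def sum_nonneg)
    with orth[OF that that] show ?thesis by (simp add: r_def field_simps)
  qed
  let ?W = "mat_of_cols n (map (\<lambda>i. r i \<cdot>\<^sub>v ws ! i) [0..<n])"
  have col: "col ?W i = r i \<cdot>\<^sub>v ws ! i" if "i < n" for i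
    using that carr[OF that] by (subst col_mat_of_cols) auto
  have W: "?W \<in> carrier_mat n n" by (auto simp: mat_of_cols_def)
  show thesis
  proof (rule that[of ?W "r 0"])
    show "?W \<in> carrier_mat n n" by (fact W)
    show "col ?W 0 = r 0 \<cdot>\<^sub>v v"
      using col[OF n] hd ws(3) n by (metis hd_conv_nth length_0_conv less_numeral_extra(3))
    show "transpose_mat ?W * ?W = 1\<^sub>m n"
    proof (rule eq_matI)
      fix i j assume "i < dim_row (1\<^sub>m n :: real mat)" "j < dim_col (1\<^sub>m n :: real mat)"
      then have ij: "i < n" "j < n" by auto
      then have "(transpose_mat ?W * ?W) $$ (i, j) = col ?W i \<bullet> col ?W j"
        using W by (subst index_mult_mat) auto
      also have "\<dots> = r i * r j * (ws ! i \<bullet> ws ! j)"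
        using carr[OF ij(1)] carr[OF ij(2)]
        by (simp add: col[OF ij(1)] col[OF ij(2)] smult_scalar_prod_distrib[of _ n] scalar_prod_smult_distrib[of _ n])
      also have "\<dots> = 1\<^sub>m n $$ (i, j)"
        using ij unit orth[OF ij] by auto
      finally show "(transpose_mat ?W * ?W) $$ (i, j) = 1\<^sub>m n $$ (i, j)" .
    qed (use W in auto)
  qed
qed

lemma mat_diag_Suc:
  "mat_diag (Suc n) (case_nat e d)
    = four_block_mat (mat_diag 1 (\<lambda>_. e)) (0\<^sub>m 1 n) (0\<^sub>m n 1) (mat_diag n d)"
  by (rule eq_matI) (auto simp: mat_diag_def split: nat.splits)

lemma mult_four_block_diag:
  fixes A B C D :: "real mat"
  assumes "A \<in> carrier_mat m m" "C \<in> carrier_mat m m" "B \<in> carrier_mat n n" "D \<in> carrier_mat n n"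
  shows "four_block_mat A (0\<^sub>m m n) (0\<^sub>m n m) B * four_block_mat C (0\<^sub>m m n) (0\<^sub>m n m) D
    = four_block_mat (A * C) (0\<^sub>m m n) (0\<^sub>m n m) (B * D)"
proof -
  have "A * C \<in> carrier_mat m m" "B * D \<in> carrier_mat n n" using assms by auto
  then show ?thesis using assms
    by (simp add: mult_four_block_mat[OF assms(1) zero_carrier_mat zero_carrier_mat assms(3,2) zero_carrier_mat zero_carrier_mat assms(4)])
qed

lemma four_block_one_conjugate_mat_diag:
  fixes Q :: "real mat"
  assumes Q: "Q \<in> carrier_mat n n"
  shows "transpose_mat (four_block_mat (1\<^sub>m 1) (0\<^sub>m 1 n) (0\<^sub>m n 1) Q)
      * four_block_mat (mat_diag 1 d') (0\<^sub>m 1 n) (0\<^sub>m n 1) (mat_diag n d)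
      * four_block_mat (1\<^sub>m 1) (0\<^sub>m 1 n) (0\<^sub>m n 1) Q
    = four_block_mat (mat_diag 1 d') (0\<^sub>m 1 n) (0\<^sub>m n 1) (transpose_mat Q * mat_diag n d * Q)"
proof -
  let ?d = "mat_diag 1 d'" and ?D = "mat_diag n d"
  have t: "transpose_mat (four_block_mat (1\<^sub>m 1) (0\<^sub>m 1 n) (0\<^sub>m n 1) Q)
      = four_block_mat (1\<^sub>m 1) (0\<^sub>m 1 n) (0\<^sub>m n 1) (transpose_mat Q)"
    using Q by (subst transpose_four_block_mat[of _ 1 1 _ n _ n]) auto
  have D: "?d \<in> carrier_mat 1 1" "?D \<in> carrier_mat n n" by auto
  have Qt: "transpose_mat Q \<in> carrier_mat n n" using Q by auto
  have QD: "transpose_mat Q * ?D \<in> carrier_mat n n" using Qt D by auto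
  show ?thesis
    unfolding t mult_four_block_diag[OF one_carrier_mat D(1) Qt D(2)]
      left_mult_one_mat[OF D(1)] mult_four_block_diag[OF D(1) one_carrier_mat QD Q] right_mult_one_mat[OF D(1)] ..
qed

text \<open>Deflation: an orthogonal matrix whose first column is an eigenvector transforms \<open>A\<close> into a matrix
  whose first column, and by symmetry first row, vanishes off the diagonal. The induction hypothesis
  diagonalizes the remaining block.\<close>

theorem symmetric_spectral_decomposition:
  assumes "A \<in> carrier_mat n n" "transpose_mat A = A"
  shows "\<exists>Q ev. spectral_decomposition A Q ev"
  using assms
proof (induction n arbitrary: A)
  case 0
  then have "spectral_decomposition A (1\<^sub>m 0) (\<lambda>_. 0)"
    unfolding spectral_decomposition_def Let_def by (auto intro!: eq_matI)
  then show ?case by blast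
next
  case (Suc n)
  let ?n = "Suc n"
  have A: "A \<in> carrier_mat ?n ?n" using Suc by simp
  obtain e v where v: "v \<in> carrier_vec ?n" "v \<noteq> 0\<^sub>v ?n" "A *\<^sub>v v = e \<cdot>\<^sub>v (1\<^sub>m ?n *\<^sub>v v)"
    using symmetric_pencil_eigenvector[OF A Suc.prems(2) pos_def_one zero_less_Suc] by blast
  then have Av: "A *\<^sub>v v = e \<cdot>\<^sub>v v" by simp
  obtain W c where W: "W \<in> carrier_mat ?n ?n" "transpose_mat W * W = 1\<^sub>m ?n" "col W 0 = c \<cdot>\<^sub>v v"
    using orthogonal_completion[OF v(1,2)] by blast
  define Wt where "Wt = transpose_mat W"
  have Wt: "Wt \<in> carrier_mat ?n ?n" "Wt * W = 1\<^sub>m ?n" "W * Wt = 1\<^sub>m ?n" "transpose_mat Wt = W"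
    using W mat_mult_left_right_inverse[of "transpose_mat W" ?n W] by (auto simp: Wt_def)
  define M where "M = Wt * A * W"
  have M: "M \<in> carrier_mat ?n ?n" using Wt A W by (auto simp: M_def)
  have "transpose_mat (Wt * A) = A * W"
    using transpose_mult[OF Wt(1) A] Suc.prems(2) Wt(4) by simp
  then have Mt: "transpose_mat M = M"
    using transpose_mult[of "Wt * A" ?n ?n W ?n] assoc_mult_mat[OF Wt(1) A W(1)] Wt(1) A W(1)
    by (simp add: M_def Wt_def)
  have sym: "M $$ (i, j) = M $$ (j, i)" if "i < ?n" "j < ?n" for i j
    using that M Mt by (metis carrier_matD index_transpose_mat(1))
  have M0: "M $$ (i, 0) = (if i = 0 then e else 0)" if i: "i < ?n" for i
  proof -
    have "col (A * W) 0 = A *\<^sub>v col W 0" using W(1) A by (intro eq_vecI) auto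
    also have "\<dots> = e \<cdot>\<^sub>v col W 0" using Av v(1) A by (simp add: W(3) mult_mat_vec smult_smult_assoc mult.commute)
    finally have "M $$ (i, 0) = row Wt i \<bullet> (e \<cdot>\<^sub>v col W 0)"
      using i Wt A W(1) by (simp add: M_def assoc_mult_mat[OF Wt(1) A W(1)])
    also have "\<dots> = e * (Wt * W) $$ (i, 0)" using i Wt(1) W(1) by simp
    finally show ?thesis using i by (simp add: Wt(2))
  qed
  define M' where "M' = mat n n (\<lambda>(i, j). M $$ (Suc i, Suc j))"
  have M': "M' \<in> carrier_mat n n" "transpose_mat M' = M'"
    using sym by (auto simp: M'_def intro!: eq_matI)
  have block: "M = four_block_mat (mat_diag 1 (\<lambda>_. e)) (0\<^sub>m 1 n) (0\<^sub>m n 1) M'"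
  proof (rule eq_matI)
    fix i j
    assume "i < dim_row (four_block_mat (mat_diag 1 (\<lambda>_. e)) (0\<^sub>m 1 n) (0\<^sub>m n 1) M')"
      "j < dim_col (four_block_mat (mat_diag 1 (\<lambda>_. e)) (0\<^sub>m 1 n) (0\<^sub>m n 1) M')"
    then have ij: "i < ?n" "j < ?n" by (auto simp: M'_def mat_diag_def)
    then show "M $$ (i, j) = four_block_mat (mat_diag 1 (\<lambda>_. e)) (0\<^sub>m 1 n) (0\<^sub>m n 1) M' $$ (i, j)"
      using M0[of i] M0[of j] sym[of i j] by (cases i; cases j) (auto simp: M'_def mat_diag_def)
  qed (use M in \<open>auto simp: M'_def mat_diag_def\<close>)
  obtain Q ev where "spectral_decomposition M' Q ev" using Suc.IH[OF M'] by blast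
  then have Q: "Q \<in> carrier_mat n n" "transpose_mat Q * Q = 1\<^sub>m n" "M' = transpose_mat Q * mat_diag n ev * Q"
    using M'(1) by (auto simp: spectral_decomposition_def Let_def)
  define Q' where "Q' = four_block_mat (1\<^sub>m 1) (0\<^sub>m 1 n) (0\<^sub>m n 1) Q"
  have Q': "Q' \<in> carrier_mat ?n ?n"
    using four_block_carrier_mat[of "1\<^sub>m 1 :: real mat" 1 1 Q n n] Q by (simp add: Q'_def)
  have Q't: "transpose_mat Q' \<in> carrier_mat ?n ?n" using Q' by simp
  have MQ: "M = transpose_mat Q' * mat_diag ?n (case_nat e ev) * Q'"
    unfolding mat_diag_Suc Q'_def four_block_one_conjugate_mat_diag[OF Q(1)] block Q(3) ..
  have Q'Q': "transpose_mat Q' * Q' = 1\<^sub>m ?n"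
    using four_block_one_conjugate_mat_diag[OF Q(1), of "\<lambda>_. 1" "\<lambda>_. 1"] Q Q' Q't
    by (simp add: Q'_def)
  have "spectral_decomposition A (Q' * Wt) (case_nat e ev)"
  proof -
    let ?D = "mat_diag ?n (case_nat e ev)"
    have D: "?D \<in> carrier_mat ?n ?n" by simp
    have tr: "transpose_mat (Q' * Wt) = W * transpose_mat Q'"
      using transpose_mult[OF Q' Wt(1)] Wt(4) by simp
    have conj: "W * transpose_mat Q' * X * (Q' * Wt) = W * (transpose_mat Q' * X * Q') * Wt"
      if "X \<in> carrier_mat ?n ?n" for X
      using that W(1) Q' Q't Wt(1) by (simp add: assoc_mult_mat[of _ ?n ?n _ ?n _ ?n])
    have "W * M * Wt = (W * Wt) * A * (W * Wt)"
      using W(1) Wt(1) A by (simp add: M_def assoc_mult_mat[of _ ?n ?n _ ?n _ ?n])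
    then have "A = transpose_mat (Q' * Wt) * ?D * (Q' * Wt)"
      unfolding tr conj[OF D] MQ[symmetric] using A Wt(3) by simp
    moreover have "transpose_mat (Q' * Wt) * (Q' * Wt) = 1\<^sub>m ?n"
    proof -
      have "W * transpose_mat Q' * (Q' * Wt) = W * (transpose_mat Q' * Q') * Wt"
        using W(1) Q' Q't Wt(1) by (simp add: assoc_mult_mat[of _ ?n ?n _ ?n _ ?n])
      then show ?thesis unfolding tr Q'Q' using W(1) Wt by simp
    qed
    ultimately show ?thesis
      using A Q' Wt(1) by (auto simp: spectral_decomposition_def Let_def)
  qed
  then show ?case by blast
qed

section \<open>Fractional powers as mixtures of resolvents\<close>

text \<open>The integrand of $\int_0^\infty t^{s-1} / (1 + t)\, dt$ after the substitution $t = e^u$, which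
  turns the scaling of $t$ by an eigenvalue into a translation of $u$.\<close>

definition stieltjes_kernel :: "real \<Rightarrow> real \<Rightarrow> real" where
  "stieltjes_kernel s u = exp (s * u) / (1 + exp u)"

lemma nn_integral_exp_decay:
  fixes c :: real
  assumes "0 < c"
  shows "(\<integral>\<^sup>+ u. ennreal (exp (- c * u)) * indicator {0..} u \<partial>lborel) < \<infinity>"
proof -
  have "(\<integral>\<^sup>+ u. ennreal (exp (- c * u)) * indicator {0..} u \<partial>lborel) = ennreal (0 - (- exp (- c * 0) / c))"
  proof (rule nn_integral_FTC_atLeast)
    show "((\<lambda>u. - exp (- c * u) / c) \<longlongrightarrow> 0) at_top"
    proof -
      have "filterlim (\<lambda>u. - c * u) at_bot at_top"
        using assms by (intro filterlim_tendsto_neg_mult_at_bot[OF tendsto_const]) (auto simp: filterlim_ident)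
      then have "((\<lambda>u. exp (- c * u)) \<longlongrightarrow> 0) at_top"
        by (rule filterlim_compose[OF exp_at_bot])
      from tendsto_divide[OF tendsto_minus[OF this] tendsto_const[of c]] assms show ?thesis by simp
    qed
  qed (use assms in \<open>auto intro!: derivative_eq_intros\<close>)
  then show ?thesis by simp
qed

lemma stieltjes_kernel_pos: "0 < stieltjes_kernel s u"
  by (simp add: stieltjes_kernel_def add_pos_pos)

lemma stieltjes_kernel_integrable:
  assumes "0 < s" "s < 1"
  shows "integrable lborel (stieltjes_kernel s)"
proof (rule integrableI_nonneg)
  have meas [measurable]: "stieltjes_kernel s \<in> borel_measurable borel"
    unfolding stieltjes_kernel_def by measurable
  then show "stieltjes_kernel s \<in> borel_measurable lborel" by simp
  show "AE u in lborel. 0 \<le> stieltjes_kernel s u"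
    using stieltjes_kernel_pos less_imp_le by blast
  \<comment> \<open>The kernel decays exponentially in both directions, with rate $1 - s$ to the right and $s$ to
    the left.\<close>
  let ?R = "\<lambda>u. ennreal (exp (- (1 - s) * u)) * indicator {0..} u"
  let ?L = "\<lambda>u. ennreal (exp (- s * u)) * indicator {0..} u"
  have bound: "ennreal (stieltjes_kernel s u) \<le> ?R u + ?L (0 + (-1) * u)" for u
  proof (cases "0 \<le> u")
    case True
    have "stieltjes_kernel s u \<le> exp (s * u) / exp u"
      unfolding stieltjes_kernel_def by (intro divide_left_mono) (auto simp: add_pos_pos)
    also have "\<dots> = exp (- (1 - s) * u)" by (simp add: exp_diff[symmetric] algebra_simps)
    finally have "ennreal (stieltjes_kernel s u) \<le> ?R u" using True by (auto intro: ennreal_leI)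
    then show ?thesis by (rule order_trans) simp
  next
    case False
    have "stieltjes_kernel s u \<le> exp (s * u) / 1"
      unfolding stieltjes_kernel_def by (intro divide_left_mono) (auto simp: add_pos_pos)
    then show ?thesis using False by (auto simp: indicator_def intro!: ennreal_leI)
  qed
  have refl: "(\<integral>\<^sup>+ u. ?L (0 + (-1) * u) \<partial>lborel) = (\<integral>\<^sup>+ u. ?L u \<partial>lborel)"
    by (subst nn_integral_real_affine[where c = "-1" and t = 0 and f = ?L]) auto
  have "(\<integral>\<^sup>+ u. ennreal (stieltjes_kernel s u) \<partial>lborel) \<le> (\<integral>\<^sup>+ u. ?R u + ?L (0 + (-1) * u) \<partial>lborel)"
    by (intro nn_integral_mono) (rule bound)
  also have "\<dots> = (\<integral>\<^sup>+ u. ?R u \<partial>lborel) + (\<integral>\<^sup>+ u. ?L u \<partial>lborel)"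
    by (subst refl[symmetric], rule nn_integral_add) auto
  also have "\<dots> < \<infinity>"
    using nn_integral_exp_decay[of "1 - s"] nn_integral_exp_decay[of s] assms by simp
  finally show "(\<integral>\<^sup>+ u. ennreal (stieltjes_kernel s u) \<partial>lborel) < \<infinity>" .
qed

lemma stieltjes_kernel_integral_pos:
  assumes "0 < s" "s < 1"
  shows "0 < integral\<^sup>L lborel (stieltjes_kernel s)"
proof -
  have "0 \<le> integral\<^sup>L lborel (stieltjes_kernel s)"
    using stieltjes_kernel_pos by (intro integral_nonneg_AE AE_I2 less_imp_le)
  moreover have "integral\<^sup>L lborel (stieltjes_kernel s) \<noteq> 0"
  proof
    assume "integral\<^sup>L lborel (stieltjes_kernel s) = 0"
    then have "AE u in lborel. stieltjes_kernel s u = 0"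
      using integral_nonneg_eq_0_iff_AE[OF stieltjes_kernel_integrable[OF assms]]
        stieltjes_kernel_pos less_imp_le by blast
    moreover have "(stieltjes_kernel s u = 0) = False" for u
      using stieltjes_kernel_pos[of s u] by simp
    ultimately have "AE u in (lborel :: real measure). False" by simp
    then show False by (simp add: eventually_False ae_filter_eq_bot_iff)
  qed
  ultimately show ?thesis by simp
qed

text \<open>Translating the kernel by $\ln \nu$ multiplies its values by $\nu^s$ and turns $1 / (1 + e^u)$ into
  $1 / (1 + e^u \nu)$, while the Lebesgue integral does not change.\<close>

lemma stieltjes_representation:
  assumes "0 < s" "s < 1" "0 < \<nu>"
  shows "has_bochner_integral lborel (\<lambda>u. exp (s * u) * (1 / (1 + exp u * \<nu>)))
           (\<nu> powr (- s) * integral\<^sup>L lborel (stieltjes_kernel s))"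
proof -
  have "has_bochner_integral lborel (stieltjes_kernel s) (integral\<^sup>L lborel (stieltjes_kernel s))"
    using has_bochner_integral_integrable stieltjes_kernel_integrable assms by blast
  then have "has_bochner_integral lborel (\<lambda>u. stieltjes_kernel s (ln \<nu> + 1 * u))
      (integral\<^sup>L lborel (stieltjes_kernel s))"
    by (subst (asm) lborel_has_bochner_integral_real_affine_iff[where c = 1 and t = "ln \<nu>"]) auto
  then have "has_bochner_integral lborel (\<lambda>u. \<nu> powr (- s) * stieltjes_kernel s (ln \<nu> + 1 * u))
      (\<nu> powr (- s) * integral\<^sup>L lborel (stieltjes_kernel s))"
    by (rule has_bochner_integral_mult_right)
  moreover have "\<nu> powr (- s) * stieltjes_kernel s (ln \<nu> + 1 * u) = exp (s * u) * (1 / (1 + exp u * \<nu>))" for u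
    using assms(3) by (simp add: stieltjes_kernel_def powr_def distrib_left exp_add exp_minus field_simps)
  ultimately show ?thesis by simp
qed

text \<open>The integral representation is available only for $0 < s < 1$; both sides are continuous in $s$, so
  the endpoints follow.\<close>

lemma powr_sums_le_closed_interval:
  fixes v w :: "'a \<Rightarrow> real" and \<mu> \<nu> :: "'a \<Rightarrow> real"
  assumes pos: "\<And>j. j \<in> J \<Longrightarrow> 0 < \<mu> j" "\<And>i. i \<in> I \<Longrightarrow> 0 < \<nu> i"
    and le: "\<And>s. 0 < s \<Longrightarrow> s < 1 \<Longrightarrow>
      (\<Sum>j\<in>J. v j * \<mu> j powr (- s)) \<le> (\<Sum>i\<in>I. w i * \<nu> i powr (- s))"
    and s: "0 \<le> s" "s \<le> 1"
  shows "(\<Sum>j\<in>J. v j * \<mu> j powr (- s)) \<le> (\<Sum>i\<in>I. w i * \<nu> i powr (- s))"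
proof -
  let ?f = "\<lambda>s. (\<Sum>j\<in>J. v j * \<mu> j powr (- s)) - (\<Sum>i\<in>I. w i * \<nu> i powr (- s))"
  have "?f s \<le> 0"
  proof (rule continuous_le_on_closure[where f = ?f and S = "{0<..<1}"])
    show "continuous_on (closure {0<..<1}) ?f"
      using pos by (intro continuous_intros) (auto simp: less_le)
  qed (use s le in auto)
  then show ?thesis by simp
qed

text \<open>A comparison of two positive operators in terms of their spectral measures at a vector, here finite
  sums of point masses: if all resolvents are ordered, so are the powers with exponents in $[-1, 0]$,
  since the latter are integrals of the former against a positive weight.\<close>

lemma resolvent_sums_le_imp_powr_sums_le:
  fixes v w :: "'a \<Rightarrow> real" and \<mu> \<nu> :: "'a \<Rightarrow> real"
  assumes pos: "\<And>j. j \<in> J \<Longrightarrow> 0 < \<mu> j" "\<And>i. i \<in> I \<Longrightarrow> 0 < \<nu> i"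
    and le: "\<And>t. 0 < t \<Longrightarrow> (\<Sum>j\<in>J. v j * (1 / (1 + t * \<mu> j))) \<le> (\<Sum>i\<in>I. w i * (1 / (1 + t * \<nu> i)))"
    and "0 \<le> s" "s \<le> 1"
  shows "(\<Sum>j\<in>J. v j * \<mu> j powr (- s)) \<le> (\<Sum>i\<in>I. w i * \<nu> i powr (- s))"
proof (rule powr_sums_le_closed_interval[OF pos _ assms(4,5)])
  fix s :: real assume s: "0 < s" "s < 1"
  let ?c = "integral\<^sup>L lborel (stieltjes_kernel s)"
  have rep: "has_bochner_integral lborel
      (\<lambda>u. \<Sum>i\<in>K. z i * (exp (s * u) * (1 / (1 + exp u * \<kappa> i)))) (\<Sum>i\<in>K. z i * (\<kappa> i powr (- s) * ?c))"
    if "\<And>i. i \<in> K \<Longrightarrow> 0 < \<kappa> i" for K and z \<kappa> :: "'a \<Rightarrow> real"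
    using that s by (intro has_bochner_integral_sum has_bochner_integral_mult_right stieltjes_representation) auto
  have "(\<Sum>j\<in>J. v j * (\<mu> j powr (- s) * ?c)) \<le> (\<Sum>i\<in>I. w i * (\<nu> i powr (- s) * ?c))"
  proof -
    let ?f = "\<lambda>u. \<Sum>j\<in>J. v j * (exp (s * u) * (1 / (1 + exp u * \<mu> j)))"
    let ?g = "\<lambda>u. \<Sum>i\<in>I. w i * (exp (s * u) * (1 / (1 + exp u * \<nu> i)))"
    have "?f u \<le> ?g u" for u
      using mult_left_mono[OF le[of "exp u"], of "exp (s * u)"]
      by (simp add: sum_distrib_left mult_ac)
    moreover have f: "has_bochner_integral lborel ?f (\<Sum>j\<in>J. v j * (\<mu> j powr (- s) * ?c))"
      by (rule rep) (rule pos)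
    moreover have g: "has_bochner_integral lborel ?g (\<Sum>i\<in>I. w i * (\<nu> i powr (- s) * ?c))"
      by (rule rep) (rule pos)
    ultimately have "integral\<^sup>L lborel ?f \<le> integral\<^sup>L lborel ?g"
      by (intro integral_mono) (auto simp: has_bochner_integral_iff)
    then show ?thesis
      using has_bochner_integral_integral_eq[OF f] has_bochner_integral_integral_eq[OF g] by simp
  qed
  then have "(\<Sum>j\<in>J. v j * \<mu> j powr (- s)) * ?c \<le> (\<Sum>i\<in>I. w i * \<nu> i powr (- s)) * ?c"
    by (simp add: sum_distrib_right mult.assoc)
  then show "(\<Sum>j\<in>J. v j * \<mu> j powr (- s)) \<le> (\<Sum>i\<in>I. w i * \<nu> i powr (- s))"
    using stieltjes_kernel_integral_pos[OF s] by simp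
qed auto

section \<open>Spectral coordinates\<close>

definition spectral_coord :: "real mat \<Rightarrow> (nat \<Rightarrow> real) \<Rightarrow> nat \<Rightarrow> real" where
  "spectral_coord Q x k = (\<Sum>j<dim_col Q. Q $$ (k, j) * x j)"

lemma bform_conjugate_mat_diag:
  assumes Q: "Q \<in> carrier_mat n n"
  shows "bform (transpose_mat Q * mat_diag n f * Q) x y
    = (\<Sum>k<n. f k * (spectral_coord Q x k * spectral_coord Q y k))"
proof -
  have "bform (transpose_mat Q * mat_diag n f * Q) x y
      = (\<Sum>i<n. \<Sum>j<n. \<Sum>k<n. f k * (Q $$ (k, i) * x i * (Q $$ (k, j) * y j)))"
    using Q by (auto simp: bform_def mat_diag_mult_right[of _ n n] scalar_prod_def lessThan_atLeast0
        sum_distrib_left sum_distrib_right mult_ac intro!: sum.cong)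
  also have "\<dots> = (\<Sum>i<n. \<Sum>k<n. \<Sum>j<n. f k * (Q $$ (k, i) * x i * (Q $$ (k, j) * y j)))"
    by (intro sum.cong refl sum.swap)
  also have "\<dots> = (\<Sum>k<n. \<Sum>i<n. \<Sum>j<n. f k * (Q $$ (k, i) * x i * (Q $$ (k, j) * y j)))"
    by (rule sum.swap)
  also have "\<dots> = (\<Sum>k<n. f k * (spectral_coord Q x k * spectral_coord Q y k))"
    using Q unfolding spectral_coord_def sum_product by (simp add: sum_distrib_left)
  finally show ?thesis .
qed

lemma spectral_coord_inner:
  assumes "Q \<in> carrier_mat n n" "transpose_mat Q * Q = 1\<^sub>m n"
  shows "(\<Sum>k<n. spectral_coord Q x k * spectral_coord Q y k) = (\<Sum>i<n. x i * y i)"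
proof -
  have "transpose_mat Q * mat_diag n (\<lambda>_. 1) * Q = 1\<^sub>m n"
    using assms by simp
  then show ?thesis
    using bform_conjugate_mat_diag[OF assms(1), of "\<lambda>_. 1" x y] bform_one[of n x y] by simp
qed

lemma spectral_coord_surj:
  assumes Q: "Q \<in> carrier_mat n n" "transpose_mat Q * Q = 1\<^sub>m n"
  obtains y where "\<And>k. k < n \<Longrightarrow> spectral_coord Q y k = z k"
proof (rule that)
  fix k assume k: "k < n"
  have "Q * transpose_mat Q = 1\<^sub>m n"
    using mat_mult_left_right_inverse[of "transpose_mat Q" n Q] Q by simp
  then have "(\<Sum>j<n. Q $$ (k, j) * Q $$ (l, j)) = (if k = l then 1 else 0)" if "l < n" for l
    using Q(1) k that
    by (auto simp: mat_eq_iff scalar_prod_def lessThan_atLeast0 dest!: spec[of _ k])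
  then have *: "(\<Sum>j<n. Q $$ (k, j) * Q $$ (l, j)) * z l = (if l = k then z l else 0)" if "l < n" for l
    using that by simp
  \<comment> \<open>The preimage of \<open>z\<close> is $Q^T z$.\<close>
  have "spectral_coord Q (\<lambda>j. \<Sum>l<n. Q $$ (l, j) * z l) k = (\<Sum>j<n. \<Sum>l<n. Q $$ (k, j) * Q $$ (l, j) * z l)"
    using Q(1) by (simp add: spectral_coord_def sum_distrib_left mult.assoc)
  also have "\<dots> = (\<Sum>l<n. (\<Sum>j<n. Q $$ (k, j) * Q $$ (l, j)) * z l)"
    by (subst sum.swap) (simp add: sum_distrib_right)
  also have "\<dots> = z k" using k * by simp
  finally show "spectral_coord Q (\<lambda>j. \<Sum>l<n. Q $$ (l, j) * z l) k = z k" .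
qed

text \<open>The definition of \<open>mat_powr\<close> chooses a spectral decomposition anew for each exponent, so nothing
  below may depend on which decomposition of \<open>A\<close> is used.\<close>

locale pos_def_spectral =
  fixes n :: nat and A Q :: "real mat" and ev :: "nat \<Rightarrow> real"
  assumes pos_def: "pos_def n A" and decomposition: "spectral_decomposition A Q ev"
begin

lemma decomposition_facts: "Q \<in> carrier_mat n n" "transpose_mat Q * Q = 1\<^sub>m n" "A = transpose_mat Q * mat_diag n ev * Q"
  using pos_def decomposition by (auto simp: pos_def_def spectral_decomposition_def Let_def)

lemma qform_mat_diag:
  "qform (transpose_mat Q * mat_diag n f * Q) x = (\<Sum>k<n. f k * (spectral_coord Q x k)\<^sup>2)"
  by (simp add: bform_conjugate_mat_diag[OF decomposition_facts(1)] power2_eq_square)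

lemma qform_eq: "qform A x = (\<Sum>k<n. ev k * (spectral_coord Q x k)\<^sup>2)"
  using qform_mat_diag[of ev x] decomposition_facts(3) by simp

lemma sum_coord_squares: "(\<Sum>k<n. (spectral_coord Q x k)\<^sup>2) = (\<Sum>i<n. (x i)\<^sup>2)"
  using spectral_coord_inner[OF decomposition_facts(1,2), of x x] by (simp add: power2_eq_square)

lemma coord_nonzero:
  assumes "\<exists>i<n. x i \<noteq> 0"
  shows "\<exists>k<n. spectral_coord Q x k \<noteq> 0"
proof (rule ccontr)
  assume "\<not> ?thesis"
  then have "(\<Sum>i<n. (x i)\<^sup>2) = 0" using sum_coord_squares[of x] by simp
  then show False using assms by (auto simp: sum_nonneg_eq_0_iff)
qed

text \<open>The form is evaluated at the vector whose only nonzero spectral coordinate is the one at \<open>k\<close>, an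
  eigenvector for \<open>ev k\<close>.\<close>

lemma ev_pos:
  assumes "k < n"
  shows "0 < ev k"
proof -
  obtain y where y: "\<And>l. l < n \<Longrightarrow> spectral_coord Q y l = (if l = k then 1 else 0)"
    using spectral_coord_surj[OF decomposition_facts(1,2), of "\<lambda>l. if l = k then 1 else 0"] by blast
  have "qform A y = (\<Sum>l<n. if l = k then ev l else 0)"
    unfolding qform_eq using y by (intro sum.cong) auto
  then have "qform A y = ev k" using assms by simp
  moreover have "\<exists>i<n. y i \<noteq> 0"
  proof (rule ccontr)
    assume "\<not> ?thesis"
    then have "spectral_coord Q y k = 0" using decomposition_facts(1) by (simp add: spectral_coord_def)
    then show False using y[OF assms] by simp
  qed
  ultimately show ?thesis using pos_def by (auto simp: pos_def_def)
qed

lemma pos_def_conjugate_mat_diag: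
  assumes "\<And>k. k < n \<Longrightarrow> 0 < f k"
  shows "pos_def n (transpose_mat Q * mat_diag n f * Q)"
proof -
  let ?D = "mat_diag n f"
  have "transpose_mat ?D = ?D" by (auto simp: mat_diag_def intro!: eq_matI)
  then have "transpose_mat (transpose_mat Q * ?D * Q) = transpose_mat Q * ?D * Q"
    using decomposition_facts(1) transpose_mult[of "transpose_mat Q * ?D" n n Q n] transpose_mult[of "transpose_mat Q" n n ?D n]
      assoc_mult_mat[of "transpose_mat Q" n n ?D n Q n] by simp
  moreover have "0 < qform (transpose_mat Q * ?D * Q) x" if x: "\<exists>i<n. x i \<noteq> 0" for x
  proof -
    obtain k where k: "k < n" "spectral_coord Q x k \<noteq> 0" using coord_nonzero[OF x] by blast
    have "0 \<le> f l * (spectral_coord Q x l)\<^sup>2" if "l \<in> {..<n}" for l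
      using assms[of l] that by simp
    moreover have "0 < f k * (spectral_coord Q x k)\<^sup>2" using assms[OF k(1)] k(2) by simp
    ultimately show ?thesis unfolding qform_mat_diag
      using k(1) by (intro sum_pos2[of _ k]) auto
  qed
  ultimately show ?thesis using decomposition_facts(1) by (auto simp: pos_def_def)
qed

lemma resolvent_functional_coords:
  "2 * (\<Sum>i<n. x i * y i) - (\<Sum>i<n. (y i)\<^sup>2) - t * qform A y
    = (\<Sum>k<n. 2 * (spectral_coord Q x k * spectral_coord Q y k) - (spectral_coord Q y k)\<^sup>2
        - t * (ev k * (spectral_coord Q y k)\<^sup>2))"
  unfolding qform_eq sum_coord_squares[of y, symmetric] spectral_coord_inner[OF decomposition_facts(1,2), of x y, symmetric]
  by (simp only: sum_distrib_left sum_subtractf)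

text \<open>In spectral coordinates the functional $y \mapsto 2 x^T y - y^T y - t\, y^T A y$ splits into one
  concave quadratic per eigenvalue; completing the square bounds it by the resolvent form
  $x^T (I + t A)^{-1} x$ on the right-hand side.\<close>

lemma resolvent_upper:
  assumes "0 < t"
  shows "2 * (\<Sum>i<n. x i * y i) - (\<Sum>i<n. (y i)\<^sup>2) - t * qform A y
    \<le> (\<Sum>k<n. (spectral_coord Q x k)\<^sup>2 * (1 / (1 + t * ev k)))"
proof -
  let ?X = "spectral_coord Q x" and ?Y = "spectral_coord Q y"
  have "2 * (\<Sum>i<n. x i * y i) - (\<Sum>i<n. (y i)\<^sup>2) - t * qform A y
      = (\<Sum>k<n. 2 * (?X k * ?Y k) - (?Y k)\<^sup>2 - t * (ev k * (?Y k)\<^sup>2))"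
    by (rule resolvent_functional_coords)
  also have "\<dots> \<le> (\<Sum>k<n. (?X k)\<^sup>2 * (1 / (1 + t * ev k)))"
  proof (rule sum_mono)
    fix k assume "k \<in> {..<n}"
    then have p: "0 < 1 + t * ev k" using assms ev_pos[of k] by (simp add: add_pos_pos)
    have "0 \<le> (?X k - (1 + t * ev k) * ?Y k)\<^sup>2 / (1 + t * ev k)" using p by simp
    also have "\<dots> = (?X k)\<^sup>2 * (1 / (1 + t * ev k)) - (2 * (?X k * ?Y k) - (1 + t * ev k) * (?Y k)\<^sup>2)"
      using p by (simp add: power2_eq_square field_simps)
    finally show "2 * (?X k * ?Y k) - (?Y k)\<^sup>2 - t * (ev k * (?Y k)\<^sup>2) \<le> (?X k)\<^sup>2 * (1 / (1 + t * ev k))"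
      by (simp add: algebra_simps)
  qed
  finally show ?thesis .
qed

text \<open>The maximizer is $y = (I + t A)^{-1} x$.\<close>

lemma resolvent_attained:
  assumes "0 < t"
  obtains y where "2 * (\<Sum>i<n. x i * y i) - (\<Sum>i<n. (y i)\<^sup>2) - t * qform A y
    = (\<Sum>k<n. (spectral_coord Q x k)\<^sup>2 * (1 / (1 + t * ev k)))"
proof -
  let ?X = "spectral_coord Q x"
  obtain y where y: "\<And>k. k < n \<Longrightarrow> spectral_coord Q y k = ?X k / (1 + t * ev k)"
    using spectral_coord_surj[OF decomposition_facts(1,2), of "\<lambda>k. ?X k / (1 + t * ev k)"] by blast
  let ?Y = "spectral_coord Q y"
  have "2 * (\<Sum>i<n. x i * y i) - (\<Sum>i<n. (y i)\<^sup>2) - t * qform A y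
      = (\<Sum>k<n. 2 * (?X k * ?Y k) - (?Y k)\<^sup>2 - t * (ev k * (?Y k)\<^sup>2))"
    by (rule resolvent_functional_coords)
  also have "\<dots> = (\<Sum>k<n. (?X k)\<^sup>2 * (1 / (1 + t * ev k)))"
  proof (rule sum.cong[OF refl])
    fix k assume "k \<in> {..<n}"
    then have p: "0 < 1 + t * ev k" and k: "k < n" using assms ev_pos[of k] by (auto simp: add_pos_pos)
    define c where "c = 1 + t * ev k"
    have "2 * (?X k * ?Y k) - (?Y k)\<^sup>2 - t * (ev k * (?Y k)\<^sup>2) = 2 * (?X k * ?Y k) - c * (?Y k)\<^sup>2"
      by (simp add: c_def algebra_simps)
    also have "\<dots> = (?X k)\<^sup>2 * (1 / c)"
      using p by (simp add: y[OF k] c_def[symmetric] power2_eq_square)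
    finally show "2 * (?X k * ?Y k) - (?Y k)\<^sup>2 - t * (ev k * (?Y k)\<^sup>2) = (?X k)\<^sup>2 * (1 / (1 + t * ev k))"
      by (simp add: c_def)
  qed
  finally show thesis by (rule that)
qed

end

lemma mat_powr_decomposition:
  assumes "pos_def n A"
  obtains Q ev where "pos_def_spectral n A Q ev"
    "mat_powr A s = transpose_mat Q * mat_diag n (\<lambda>i. ev i powr s) * Q"
proof -
  have A: "A \<in> carrier_mat n n" "transpose_mat A = A" using assms by (auto simp: pos_def_def)
  let ?P = "\<lambda>M. \<exists>Q ev. spectral_decomposition A Q ev \<and>
      M = transpose_mat Q * mat_diag (dim_row A) (\<lambda>i. ev i powr s) * Q"
  have "\<exists>M. ?P M" using symmetric_spectral_decomposition[OF A] by blast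
  then have "?P (mat_powr A s)" unfolding mat_powr_def by (rule someI_ex)
  with A assms that show thesis by (auto simp: pos_def_spectral_def)
qed

lemma pos_def_mat_powr:
  assumes "pos_def n A"
  shows "pos_def n (mat_powr A s)"
proof -
  obtain Q ev where *: "pos_def_spectral n A Q ev"
    "mat_powr A s = transpose_mat Q * mat_diag n (\<lambda>i. ev i powr s) * Q"
    using mat_powr_decomposition[OF assms] .
  interpret pos_def_spectral n A Q ev by fact
  show ?thesis unfolding *(2)
    by (rule pos_def_conjugate_mat_diag) (auto dest: ev_pos)
qed

section \<open>The Loewner--Heinz inequality\<close>

text \<open>The resolvent form is a maximum of functionals that decrease when the matrix increases.\<close>

lemma resolvent_antimono:
  assumes A: "pos_def_spectral n A Q ev" and B: "pos_def_spectral n B R mv"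
    and c: "0 < c" and le: "\<And>y. qform A y \<le> c * qform B y" and t: "0 < t"
  shows "(\<Sum>k<n. (spectral_coord R x k)\<^sup>2 * (1 / (1 + t * (c * mv k))))
    \<le> (\<Sum>k<n. (spectral_coord Q x k)\<^sup>2 * (1 / (1 + t * ev k)))"
proof -
  interpret A: pos_def_spectral n A Q ev by fact
  interpret B: pos_def_spectral n B R mv by fact
  obtain y where "2 * (\<Sum>i<n. x i * y i) - (\<Sum>i<n. (y i)\<^sup>2) - (t * c) * qform B y
      = (\<Sum>k<n. (spectral_coord R x k)\<^sup>2 * (1 / (1 + (t * c) * mv k)))"
    using B.resolvent_attained[of "t * c" x] c t by auto
  moreover have "t * qform A y \<le> t * c * qform B y"
    using le[of y] t by (simp add: mult.assoc)
  ultimately show ?thesis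
    using A.resolvent_upper[OF t, of x y] by (simp add: mult.assoc)
qed

text \<open>Resolvents are antitone and negative powers are positive mixtures of them, so negative powers are
  antitone as well.\<close>

theorem loewner_heinz_negative:
  assumes "pos_def n A" "pos_def n B" and c: "0 < c"
    and le: "\<And>y. qform A y \<le> c * qform B y" and "0 \<le> \<alpha>" "\<alpha> \<le> 1"
  shows "qform (mat_powr B (- \<alpha>)) x \<le> c powr \<alpha> * qform (mat_powr A (- \<alpha>)) x"
proof -
  obtain Q ev where A: "pos_def_spectral n A Q ev"
    "mat_powr A (- \<alpha>) = transpose_mat Q * mat_diag n (\<lambda>i. ev i powr (- \<alpha>)) * Q"
    using mat_powr_decomposition[OF assms(1)] .
  obtain R mv where B: "pos_def_spectral n B R mv"
    "mat_powr B (- \<alpha>) = transpose_mat R * mat_diag n (\<lambda>i. mv i powr (- \<alpha>)) * R"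
    using mat_powr_decomposition[OF assms(2)] .
  interpret A: pos_def_spectral n A Q ev by fact
  interpret B: pos_def_spectral n B R mv by fact
  have "(\<Sum>k<n. (spectral_coord R x k)\<^sup>2 * (c * mv k) powr (- \<alpha>))
      \<le> (\<Sum>k<n. (spectral_coord Q x k)\<^sup>2 * ev k powr (- \<alpha>))"
    by (rule resolvent_sums_le_imp_powr_sums_le)
      (use A.ev_pos B.ev_pos c assms(5,6) resolvent_antimono[OF A(1) B(1) c le] in auto)
  also have "(\<Sum>k<n. (spectral_coord R x k)\<^sup>2 * (c * mv k) powr (- \<alpha>)) = c powr (- \<alpha>) * qform (mat_powr B (- \<alpha>)) x"
    unfolding B(2) B.qform_mat_diag sum_distrib_left
    by (intro sum.cong refl) (use c B.ev_pos in \<open>simp add: powr_mult less_imp_le mult_ac\<close>)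
  also have "(\<Sum>k<n. (spectral_coord Q x k)\<^sup>2 * ev k powr (- \<alpha>)) = qform (mat_powr A (- \<alpha>)) x"
    unfolding A(2) A.qform_mat_diag by (simp add: mult.commute)
  finally show ?thesis using c by (simp add: powr_minus field_simps)
qed

text \<open>Positive powers are negative powers of the reciprocals of the eigenvalues, and
  $1 / (1 + t \lambda^{-1}) = 1 - 1 / (1 + t^{-1} \lambda)$ reverses the order of the resolvents.
  The constant terms agree on both sides because orthogonal matrices preserve
  $\sum_i x_i^2$.\<close>

theorem loewner_heinz:
  assumes "pos_def n A" "pos_def n B" and c: "0 < c"
    and le: "\<And>y. qform A y \<le> c * qform B y" and "0 \<le> \<alpha>" "\<alpha> \<le> 1"
  shows "qform (mat_powr A \<alpha>) x \<le> c powr \<alpha> * qform (mat_powr B \<alpha>) x"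
proof -
  obtain Q ev where A: "pos_def_spectral n A Q ev"
    "mat_powr A \<alpha> = transpose_mat Q * mat_diag n (\<lambda>i. ev i powr \<alpha>) * Q"
    using mat_powr_decomposition[OF assms(1)] .
  obtain R mv where B: "pos_def_spectral n B R mv"
    "mat_powr B \<alpha> = transpose_mat R * mat_diag n (\<lambda>i. mv i powr \<alpha>) * R"
    using mat_powr_decomposition[OF assms(2)] .
  interpret A: pos_def_spectral n A Q ev by fact
  interpret B: pos_def_spectral n B R mv by fact
  have complement: "1 / (1 + t * (1 / l)) = 1 - 1 / (1 + (1 / t) * l)" if "0 < t" "0 < l" for t l :: real
  proof -
    have "1 + t * (1 / l) = (l + t) / l" "1 + (1 / t) * l = (l + t) / t"
      using that by (auto simp: field_simps)
    moreover have "0 < l + t" using that by simp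
    ultimately show ?thesis by (simp add: field_simps)
  qed
  have "(\<Sum>k<n. (spectral_coord Q x k)\<^sup>2 * (1 / (1 + t * (1 / ev k))))
      \<le> (\<Sum>k<n. (spectral_coord R x k)\<^sup>2 * (1 / (1 + t * (1 / (c * mv k)))))" if t: "0 < t" for t
  proof -
    have "(\<Sum>k<n. (spectral_coord Q x k)\<^sup>2 * (1 / (1 + t * (1 / ev k))))
       = (\<Sum>k<n. (spectral_coord Q x k)\<^sup>2 - (spectral_coord Q x k)\<^sup>2 * (1 / (1 + (1 / t) * ev k)))"
      by (intro sum.cong refl) (simp only: complement[OF t A.ev_pos] lessThan_iff right_diff_distrib mult_1_right)
    moreover have "(\<Sum>k<n. (spectral_coord R x k)\<^sup>2 * (1 / (1 + t * (1 / (c * mv k)))))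
       = (\<Sum>k<n. (spectral_coord R x k)\<^sup>2 - (spectral_coord R x k)\<^sup>2 * (1 / (1 + (1 / t) * (c * mv k))))"
      by (intro sum.cong refl) (simp only: complement[OF t mult_pos_pos[OF c B.ev_pos]] lessThan_iff right_diff_distrib mult_1_right)
    moreover have t': "0 < 1 / t" using t by simp
    ultimately show ?thesis
      using resolvent_antimono[OF A(1) B(1) c le t', of x] A.sum_coord_squares[of x] B.sum_coord_squares[of x]
      by (simp only: sum_subtractf)
  qed
  then have "(\<Sum>k<n. (spectral_coord Q x k)\<^sup>2 * (1 / ev k) powr (- \<alpha>))
      \<le> (\<Sum>k<n. (spectral_coord R x k)\<^sup>2 * (1 / (c * mv k)) powr (- \<alpha>))"
    by (intro resolvent_sums_le_imp_powr_sums_le) (use A.ev_pos B.ev_pos c assms(5,6) in auto)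
  also have "(\<Sum>k<n. (spectral_coord Q x k)\<^sup>2 * (1 / ev k) powr (- \<alpha>)) = qform (mat_powr A \<alpha>) x"
    unfolding A(2) A.qform_mat_diag
    by (intro sum.cong refl) (use A.ev_pos in \<open>simp add: powr_minus powr_divide less_imp_le\<close>)
  also have "(\<Sum>k<n. (spectral_coord R x k)\<^sup>2 * (1 / (c * mv k)) powr (- \<alpha>)) = c powr \<alpha> * qform (mat_powr B \<alpha>) x"
    unfolding B(2) B.qform_mat_diag sum_distrib_left
    by (intro sum.cong refl) (use c B.ev_pos in \<open>simp add: powr_minus powr_divide powr_mult less_imp_le mult_ac\<close>)
  finally show ?thesis .
qed

section \<open>Condition numbers of preconditioned matrices\<close>

text \<open>For an eigenvector $v$ with $P^{-1} F v = e v$, the eigenvalue $e$ is the Rayleigh quotient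
  $v^T F v / v^T P v$, which lies between \<open>L\<close> and \<open>U\<close>.\<close>

lemma spectral_cond_le:
  assumes P: "pos_def n P" and F: "F \<in> carrier_mat n n" "transpose_mat F = F" and n: "0 < n"
    and L: "0 < L" "\<And>x. L * qform P x \<le> qform F x" and U: "\<And>x. qform F x \<le> U * qform P x"
  shows "spectral_cond (the (mat_inverse P) * F) \<le> U / L"
proof -
  let ?R = "the (mat_inverse P)"
  let ?S = "spectrum (?R * F)"
  have Pc: "P \<in> carrier_mat n n" using P by (simp add: pos_def_def)
  note R = pos_def_mat_inverse[OF P]
  have RF: "?R * F \<in> carrier_mat n n" using R(1) F(1) by simp
  have fin: "finite ?S" using card_finite_spectrum[OF RF] by simp
  have bounds: "L \<le> e \<and> e \<le> U" if "e \<in> ?S" for e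
  proof -
    from that obtain v where v: "v \<in> carrier_vec n" "v \<noteq> 0\<^sub>v n" "(?R * F) *\<^sub>v v = e \<cdot>\<^sub>v v"
      using RF by (auto simp: spectrum_def eigenvalue_def eigenvector_def)
    have "F *\<^sub>v v = (P * ?R) *\<^sub>v (F *\<^sub>v v)" using R(3) F(1) v(1) by simp
    also have "\<dots> = P *\<^sub>v ((?R * F) *\<^sub>v v)"
      using Pc R(1) F(1) v(1) by (simp add: assoc_mult_mat_vec[of _ n n _ n])
    also have "\<dots> = e \<cdot>\<^sub>v (P *\<^sub>v v)" using Pc v(1) by (simp add: v(3) mult_mat_vec)
    finally have Fv: "F *\<^sub>v v = e \<cdot>\<^sub>v (P *\<^sub>v v)" .
    let ?x = "\<lambda>i. v $ i"
    have "qform F ?x = e * qform P ?x"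
      using Pc v(1) by (simp add: bform_conv_mult_mat_vec[OF F(1) v(1)] bform_conv_mult_mat_vec[OF Pc v(1)]
          Fv sum_distrib_left mult.left_commute del: index_mult_mat_vec)
    moreover have "\<exists>i<n. ?x i \<noteq> 0" using v(1,2) by (auto simp: vec_eq_iff)
    then have "0 < qform P ?x" using P unfolding pos_def_def by blast
    ultimately show ?thesis using L(2)[of ?x] U[of ?x] by simp
  qed
  have ne: "?S \<noteq> {}"
  proof -
    obtain e v where v: "v \<in> carrier_vec n" "v \<noteq> 0\<^sub>v n" "F *\<^sub>v v = e \<cdot>\<^sub>v (P *\<^sub>v v)"
      using symmetric_pencil_eigenvector[OF F P n] by blast
    have "(?R * F) *\<^sub>v v = ?R *\<^sub>v (e \<cdot>\<^sub>v (P *\<^sub>v v))"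
      using R(1) F(1) v by simp
    also have "\<dots> = e \<cdot>\<^sub>v ((?R * P) *\<^sub>v v)"
      using R(1) Pc v(1) by (simp add: mult_mat_vec[of _ n n] assoc_mult_mat_vec[of _ n n _ n])
    finally have "(?R * F) *\<^sub>v v = e \<cdot>\<^sub>v v" using R(2) v(1) by simp
    then have "e \<in> ?S" using v(1,2) R(1) by (auto simp: spectrum_def eigenvalue_def eigenvector_def)
    then show ?thesis by blast
  qed
  have "L \<le> Min ?S" "Max ?S \<le> U" using fin ne bounds by auto
  moreover have "L \<le> U" using bounds ne by force
  ultimately show ?thesis unfolding spectral_cond_def
    using L(1) by (intro frac_le) auto
qed

lemma qform_F2:
  assumes "pos_def n A"
  shows "qform (F2 \<alpha> \<beta> \<gamma> A) x = \<beta> * qform (mat_powr A (- \<alpha>)) x + \<gamma> / \<beta> * qform (mat_powr A \<alpha>) x"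
  using pos_def_mat_powr[OF assms, of "- \<alpha>"] pos_def_mat_powr[OF assms, of \<alpha>]
  unfolding F2_def pos_def_def by (subst bform_add[of _ n]) (auto simp: bform_smult)

lemma pos_def_F2:
  assumes "pos_def n A" "0 < \<beta>" "0 < \<gamma>"
  shows "pos_def n (F2 \<alpha> \<beta> \<gamma> A)"
proof -
  note p = pos_def_mat_powr[OF assms(1), unfolded pos_def_def]
  have "F2 \<alpha> \<beta> \<gamma> A \<in> carrier_mat n n" using p by (auto simp: F2_def)
  moreover have "transpose_mat (F2 \<alpha> \<beta> \<gamma> A) = F2 \<alpha> \<beta> \<gamma> A"
  proof -
    have smult: "transpose_mat (c \<cdot>\<^sub>m M) = c \<cdot>\<^sub>m transpose_mat M" for c :: real and M
      by (rule eq_matI) auto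
    show ?thesis using p[of "- \<alpha>"] p[of \<alpha>] by (simp add: F2_def transpose_add[of _ n n] smult)
  qed
  moreover have "0 < qform (F2 \<alpha> \<beta> \<gamma> A) x" if "\<exists>i<n. x i \<noteq> 0" for x
    unfolding qform_F2[OF assms(1)] using p that assms(2,3) by (intro add_pos_pos mult_pos_pos) auto
  ultimately show ?thesis by (simp add: pos_def_def)
qed

text \<open>Both summands of $\mathcal F_2$ are compared separately: $A \le (1 + q) B$ bounds $A^\alpha$ from
  above and $A^{-\alpha}$ from below, and $B \le (1 - q)^{-1} A$ does the opposite.\<close>

lemma spectral_cond_F2_le:
  assumes A: "pos_def N A" and B: "pos_def N B" and N: "0 < N"
    and \<alpha>: "0 \<le> \<alpha>" "\<alpha> \<le> 1" and \<beta>: "0 < \<beta>" and \<gamma>: "0 < \<gamma>" and q: "0 < q" "q < 1"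
    and lower: "\<And>x. (1 - q) * qform B x \<le> qform A x"
    and upper: "\<And>x. qform A x \<le> (1 + q) * qform B x"
  shows "spectral_cond (the (mat_inverse (F2 \<alpha> \<beta> \<gamma> B)) * F2 \<alpha> \<beta> \<gamma> A)
    \<le> max ((1 + q) powr \<alpha>) ((1 - q) powr (- \<alpha>)) / min ((1 + q) powr (- \<alpha>)) ((1 - q) powr \<alpha>)"
    (is "_ \<le> ?U / ?L")
proof (rule spectral_cond_le)
  show "pos_def N (F2 \<alpha> \<beta> \<gamma> B)" using pos_def_F2[OF B \<beta> \<gamma>] .
  show "F2 \<alpha> \<beta> \<gamma> A \<in> carrier_mat N N" "transpose_mat (F2 \<alpha> \<beta> \<gamma> A) = F2 \<alpha> \<beta> \<gamma> A"
    using pos_def_F2[OF A \<beta> \<gamma>] by (auto simp: pos_def_def)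
  show "0 < N" by fact
  show "0 < ?L" using q by simp
  have lower': "qform B x \<le> 1 / (1 - q) * qform A x" for x
    using lower[of x] q by (simp add: field_simps)
  have inv: "(1 / (1 - q)) powr \<alpha> = (1 - q) powr (- \<alpha>)"
    using q by (simp add: powr_minus powr_divide field_simps)
  have pos: "0 < 1 + q" "0 < 1 / (1 - q)" using q by auto
  have nonneg: "0 \<le> qform (mat_powr B s) x" for s x
  proof (cases "\<exists>i<N. x i \<noteq> 0")
    case True
    then show ?thesis using pos_def_mat_powr[OF B, of s] by (auto simp: pos_def_def less_imp_le)
  next
    case False
    have "dim_row (mat_powr B s) = N" using pos_def_mat_powr[OF B, of s] by (auto simp: pos_def_def)
    then have "qform (mat_powr B s) x = 0" using False by (simp add: bform_def)
    then show ?thesis by simp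
  qed
  fix x
  let ?Bp = "qform (mat_powr B \<alpha>) x" and ?Bm = "qform (mat_powr B (- \<alpha>)) x"
  let ?Ap = "qform (mat_powr A \<alpha>) x" and ?Am = "qform (mat_powr A (- \<alpha>)) x"
  have "?Am \<le> (1 - q) powr (- \<alpha>) * ?Bm"
    using loewner_heinz_negative[OF B A pos(2) lower' \<alpha>] unfolding inv .
  also have "\<dots> \<le> ?U * ?Bm" by (intro mult_right_mono nonneg) simp
  finally have Am: "?Am \<le> ?U * ?Bm" .
  have "?Ap \<le> (1 + q) powr \<alpha> * ?Bp" by (rule loewner_heinz[OF A B pos(1) upper \<alpha>])
  also have "\<dots> \<le> ?U * ?Bp" by (intro mult_right_mono nonneg) simp
  finally have Ap: "?Ap \<le> ?U * ?Bp" .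
  have "\<beta> * ?Am + \<gamma> / \<beta> * ?Ap \<le> \<beta> * (?U * ?Bm) + \<gamma> / \<beta> * (?U * ?Bp)"
    using Am Ap \<beta> \<gamma> by (intro add_mono mult_left_mono) auto
  then show "qform (F2 \<alpha> \<beta> \<gamma> A) x \<le> ?U * qform (F2 \<alpha> \<beta> \<gamma> B) x"
    unfolding qform_F2[OF A] qform_F2[OF B] by (simp add: distrib_left mult.left_commute)
  have "?L * ?Bm \<le> (1 + q) powr (- \<alpha>) * ?Bm" by (intro mult_right_mono nonneg) simp
  also have "\<dots> \<le> ?Am"
    using loewner_heinz_negative[OF A B pos(1) upper \<alpha>, of x] q by (simp add: powr_minus field_simps)
  finally have Bm: "?L * ?Bm \<le> ?Am" .
  have "?L * ?Bp \<le> (1 - q) powr \<alpha> * ?Bp" by (intro mult_right_mono nonneg) simp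
  also have "\<dots> \<le> ?Ap"
    using loewner_heinz[OF B A pos(2) lower' \<alpha>, of x] q unfolding inv by (simp add: powr_minus field_simps)
  finally have Bp: "?L * ?Bp \<le> ?Ap" .
  have "\<beta> * (?L * ?Bm) + \<gamma> / \<beta> * (?L * ?Bp) \<le> \<beta> * ?Am + \<gamma> / \<beta> * ?Ap"
    using Bm Bp \<beta> \<gamma> by (intro add_mono mult_left_mono) auto
  then show "?L * qform (F2 \<alpha> \<beta> \<gamma> B) x \<le> qform (F2 \<alpha> \<beta> \<gamma> A) x"
    unfolding qform_F2[OF A] qform_F2[OF B] by (simp add: distrib_left mult.left_commute)
qed

section \<open>Kronecker products\<close>

text \<open>The index convention of \<open>kronecker\<close>: a pair $(i, k)$ is stored at position $i m + k$.\<close>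

lemma sum_lessThan_times:
  fixes f :: "nat \<Rightarrow> real"
  shows "(\<Sum>i<n * m. f i) = (\<Sum>i<n. \<Sum>k<m. f (i * m + k))"
proof -
  have "(\<Sum>i<n * m. f i) = (\<Sum>i<n. sum f {i * m..<i * m + m})"
    by (rule sum.nat_group[symmetric])
  moreover have "sum f {i * m..<i * m + m} = (\<Sum>k<m. f (i * m + k))" for i
    using sum.shift_bounds_nat_ivl[of f 0 "i * m" m] by (simp add: lessThan_atLeast0 add.commute)
  ultimately show ?thesis by simp
qed

lemma nat_pair_less_times:
  fixes i :: nat
  assumes "i < n" "k < m"
  shows "i * m + k < n * m"
proof -
  have "i * m + k < Suc i * m" using assms by simp
  also have "\<dots> \<le> n * m" using assms by (intro mult_le_mono1) simp
  finally show ?thesis .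
qed

lemma kronecker_carrier:
  assumes "M \<in> carrier_mat n n" "N \<in> carrier_mat m m"
  shows "M \<otimes>\<^sub>K N \<in> carrier_mat (n * m) (n * m)"
  using assms by (auto simp: kronecker_def)

lemma kronecker_index:
  assumes "M \<in> carrier_mat n n" "N \<in> carrier_mat m m" "i < n" "k < m" "j < n" "l < m"
  shows "(M \<otimes>\<^sub>K N) $$ (i * m + k, j * m + l) = M $$ (i, j) * N $$ (k, l)"
proof -
  have "i * m + k < n * m" "j * m + l < n * m"
    using assms nat_pair_less_times by auto
  then show ?thesis using assms by (auto simp: kronecker_def)
qed

lemma kronecker_one_one: "1\<^sub>m n \<otimes>\<^sub>K 1\<^sub>m m = 1\<^sub>m (n * m)"
proof (rule eq_matI)
  fix i j assume "i < dim_row (1\<^sub>m (n * m) :: real mat)" "j < dim_col (1\<^sub>m (n * m) :: real mat)"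
  then have ij: "i < n * m" "j < n * m" by auto
  then have "i div m < n" "j div m < n" "i mod m < m" "j mod m < m"
    by (auto simp: less_mult_imp_div_less) (metis mod_less_divisor mult_0_right not_less_zero gr0I)+
  moreover have "i = j \<longleftrightarrow> i div m = j div m \<and> i mod m = j mod m"
    by (metis div_mult_mod_eq)
  ultimately show "(1\<^sub>m n \<otimes>\<^sub>K 1\<^sub>m m) $$ (i, j) = 1\<^sub>m (n * m) $$ (i, j)"
    using ij by (auto simp: kronecker_def)
qed (auto simp: kronecker_def)

lemma kronecker_transpose:
  assumes "M \<in> carrier_mat n n" "N \<in> carrier_mat m m" "transpose_mat M = M" "transpose_mat N = N"
  shows "transpose_mat (M \<otimes>\<^sub>K N) = M \<otimes>\<^sub>K N"
proof (rule eq_matI)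
  fix i j assume "i < dim_row (M \<otimes>\<^sub>K N)" "j < dim_col (M \<otimes>\<^sub>K N)"
  then have ij: "i < n * m" "j < n * m" using assms by (auto simp: kronecker_def)
  then have "i div m < n" "j div m < n" "i mod m < m" "j mod m < m"
    by (auto simp: less_mult_imp_div_less) (metis mod_less_divisor mult_0_right not_less_zero gr0I)+
  moreover have "M $$ (k, l) = M $$ (l, k)" if "k < n" "l < n" for k l
    using that assms(1,3) by (metis carrier_matD index_transpose_mat(1))
  moreover have "N $$ (k, l) = N $$ (l, k)" if "k < m" "l < m" for k l
    using that assms(2,4) by (metis carrier_matD index_transpose_mat(1))
  ultimately show "transpose_mat (M \<otimes>\<^sub>K N) $$ (i, j) = (M \<otimes>\<^sub>K N) $$ (i, j)"
    using ij assms(1,2) by (auto simp: kronecker_def)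
qed (use assms in \<open>auto simp: kronecker_def\<close>)

lemma bform_kronecker:
  assumes M: "M \<in> carrier_mat n n" and N: "N \<in> carrier_mat m m"
  shows "bform (M \<otimes>\<^sub>K N) x y =
    (\<Sum>i<n. \<Sum>k<m. \<Sum>j<n. \<Sum>l<m. x (i * m + k) * (M $$ (i, j) * N $$ (k, l) * y (j * m + l)))"
  using kronecker_carrier[OF M N]
  by (auto simp: bform_def sum_lessThan_times kronecker_index[OF M N] intro!: sum.cong)

text \<open>A Kronecker product with an identity matrix acts on each slice of the vector separately.\<close>

lemma qform_kronecker_one_right:
  assumes M: "M \<in> carrier_mat n n"
  shows "qform (M \<otimes>\<^sub>K 1\<^sub>m m) x = (\<Sum>k<m. qform M (\<lambda>i. x (i * m + k)))"
proof -
  have "(\<Sum>l<m. x (i * m + k) * (M $$ (i, j) * 1\<^sub>m m $$ (k, l) * x (j * m + l)))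
      = (\<Sum>l<m. if l = k then x (i * m + k) * (M $$ (i, j) * x (j * m + k)) else 0)" if "k < m" for i j k
    using that by (intro sum.cong) auto
  then have "qform (M \<otimes>\<^sub>K 1\<^sub>m m) x = (\<Sum>i<n. \<Sum>k<m. \<Sum>j<n. x (i * m + k) * (M $$ (i, j) * x (j * m + k)))"
    by (simp add: bform_kronecker[OF M one_carrier_mat])
  also have "\<dots> = (\<Sum>k<m. qform M (\<lambda>i. x (i * m + k)))"
    using M by (subst sum.swap) (simp add: bform_def)
  finally show ?thesis .
qed

lemma qform_kronecker_one_left:
  assumes M: "M \<in> carrier_mat m m"
  shows "qform (1\<^sub>m n \<otimes>\<^sub>K M) x = (\<Sum>i<n. qform M (\<lambda>k. x (i * m + k)))"
proof -
  have "(\<Sum>j<n. \<Sum>l<m. x (i * m + k) * (1\<^sub>m n $$ (i, j) * M $$ (k, l) * x (j * m + l)))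
      = (\<Sum>j<n. if j = i then (\<Sum>l<m. x (i * m + k) * (M $$ (k, l) * x (i * m + l))) else 0)" if "i < n" for i k
    using that by (intro sum.cong) (auto simp: sum_distrib_left)
  then show ?thesis
    using M by (simp add: bform_kronecker[OF one_carrier_mat M]) (simp add: bform_def)
qed

section \<open>Energies of finite difference matrices\<close>

lemma fd_matrix_carrier [simp]: "fd_matrix a n \<in> carrier_mat n n"
  by (simp add: fd_matrix_def Let_def)

lemma fd_matrix_transpose: "transpose_mat (fd_matrix a n) = fd_matrix a n"
proof (rule eq_matI)
  fix i j assume "i < dim_row (fd_matrix a n)" "j < dim_col (fd_matrix a n)"
  then have "i < n" "j < n" by (auto simp: fd_matrix_def Let_def)
  moreover have "fd_entry a n (Suc j) (Suc i) = fd_entry a n (Suc i) (Suc j)"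
    by (auto simp: fd_entry_def Let_def)
  ultimately show "transpose_mat (fd_matrix a n) $$ (i, j) = fd_matrix a n $$ (i, j)"
    by (simp add: fd_matrix_def Let_def)
qed (auto simp: fd_matrix_def Let_def)

text \<open>The value at the midpoint $(i + 3/2) h$ between the grid points that carry the 0-based indices
  \<open>i\<close> and \<open>i + 1\<close>, that is, $x_{i+1}$ and $x_{i+2}$.\<close>

definition midpoint_value :: "(real \<Rightarrow> real) \<Rightarrow> nat \<Rightarrow> nat \<Rightarrow> real" where
  "midpoint_value a n i = a ((real i + 3/2) * (1 / (real n + 1)))"

text \<open>The two boundary terms are the energy between the outermost grid points and the homogeneous boundary
  values. The scheme gives them the coefficients of the neighbouring interior midpoints,
  which are those with indices \<open>0\<close> and \<open>n - 2\<close>.\<close>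

definition dirichlet_energy :: "(real \<Rightarrow> real) \<Rightarrow> nat \<Rightarrow> (nat \<Rightarrow> real) \<Rightarrow> real" where
  "dirichlet_energy a n x = (real n + 1)\<^sup>2 *
    (midpoint_value a n 0 * (x 0)\<^sup>2 + midpoint_value a n (n - 2) * (x (n - 1))\<^sup>2
      + (\<Sum>i<n - 1. midpoint_value a n i * (x (Suc i) - x i)\<^sup>2))"

lemma fd_entry_midpoint:
  "fd_entry a n (Suc i) (Suc j) = (if j = Suc i then midpoint_value a n i
     else if i = Suc j then midpoint_value a n j
     else if i = j then
       (if i = 0 then - 2 * midpoint_value a n 0
        else if Suc i = n then - 2 * midpoint_value a n (i - 1)
        else - midpoint_value a n i - midpoint_value a n (i - 1))
     else 0)"
proof -
  have plus: "a ((real (Suc l) + 1/2) * (1 / (real n + 1))) = midpoint_value a n l" for l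
    unfolding midpoint_value_def by (rule arg_cong[of _ _ a]) simp
  have minus: "a ((real (Suc (Suc l)) - 1/2) * (1 / (real n + 1))) = midpoint_value a n l" for l
    unfolding midpoint_value_def by (rule arg_cong[of _ _ a]) simp
  show ?thesis
  proof (cases i)
    case 0
    then show ?thesis unfolding fd_entry_def Let_def plus by auto
  next
    case (Suc l)
    show ?thesis unfolding Suc fd_entry_def Let_def plus minus by auto
  qed
qed

text \<open>Summation by parts.\<close>

lemma qform_fd_matrix:
  assumes "2 \<le> n"
  shows "qform (fd_matrix a n) x = dirichlet_energy a n x"
proof -
  obtain m where n: "n = Suc (Suc m)"
    using assms by (metis add_2_eq_Suc le_Suc_ex)
  let ?p = "midpoint_value a n"
  let ?d = "\<lambda>i. if i = 0 then 2 * ?p 0 else if i = Suc m then 2 * ?p m else ?p i + ?p (i - 1)"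
  have entry: "- fd_entry a n (Suc i) (Suc j) =
      (if j = i then ?d i else 0) - (if j = Suc i then ?p i else 0) - (if i = Suc j then ?p j else 0)"
    if "i < n" "j < n" for i j
    using that by (auto simp: fd_entry_midpoint n)
  have "qform (fd_matrix a n) x = (\<Sum>i<n. \<Sum>j<n. (real n + 1)\<^sup>2 * (x i * (- fd_entry a n (Suc i) (Suc j) * x j)))"
    unfolding bform_def by (auto simp: fd_matrix_def Let_def power_divide intro!: sum.cong)
  also have "\<dots> = (real n + 1)\<^sup>2 * (\<Sum>i<n. \<Sum>j<n. x i * (- fd_entry a n (Suc i) (Suc j) * x j))"
    by (simp add: sum_distrib_left)
  also have "(\<Sum>i<n. \<Sum>j<n. x i * (- fd_entry a n (Suc i) (Suc j) * x j))
      = (\<Sum>i<n. \<Sum>j<n. (if j = i then ?d i * (x i)\<^sup>2 else 0)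
          - (if j = Suc i then ?p i * (x (Suc i) * x i) else 0) - (if i = Suc j then ?p j * (x (Suc j) * x j) else 0))"
    by (intro sum.cong refl) (auto simp: entry power2_eq_square)
  also have "\<dots> = (\<Sum>i<n. \<Sum>j<n. if j = i then ?d i * (x i)\<^sup>2 else 0)
      - (\<Sum>i<n. \<Sum>j<n. if j = Suc i then ?p i * (x (Suc i) * x i) else 0)
      - (\<Sum>i<n. \<Sum>j<n. if i = Suc j then ?p j * (x (Suc j) * x j) else 0)"
    by (simp only: sum_subtractf)
  also have "(\<Sum>i<n. \<Sum>j<n. if i = Suc j then ?p j * (x (Suc j) * x j) else 0)
      = (\<Sum>i<n. \<Sum>j<n. if j = Suc i then ?p i * (x (Suc i) * x i) else 0)"
    by (subst sum.swap) simp
  also have "(\<Sum>i<n. \<Sum>j<n. if j = Suc i then ?p i * (x (Suc i) * x i) else 0)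
      = (\<Sum>i<Suc m. ?p i * (x (Suc i) * x i))"
  proof -
    let ?c = "\<lambda>i. ?p i * (x (Suc i) * x i)"
    have "(\<Sum>j<n. if j = Suc i then ?c i else 0) = (if i < Suc m then ?c i else 0)" if "i < n" for i
      by (simp add: sum.delta n)
    then have "(\<Sum>i<n. \<Sum>j<n. if j = Suc i then ?c i else 0) = (\<Sum>i<n. if i < Suc m then ?c i else 0)"
      by (intro sum.cong) auto
    also have "\<dots> = (\<Sum>i<Suc m. if i < Suc m then ?c i else 0)"
      unfolding n by (subst sum.lessThan_Suc) simp
    also have "\<dots> = (\<Sum>i<Suc m. ?c i)" by (intro sum.cong) auto
    finally show ?thesis .
  qed
  also have "(\<Sum>i<n. \<Sum>j<n. if j = i then ?d i * (x i)\<^sup>2 else 0) = (\<Sum>i<n. ?d i * (x i)\<^sup>2)"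
    by (simp add: sum.delta)
  also have "(\<Sum>i<n. ?d i * (x i)\<^sup>2) - (\<Sum>i<Suc m. ?p i * (x (Suc i) * x i)) - (\<Sum>i<Suc m. ?p i * (x (Suc i) * x i))
      = ?p 0 * (x 0)\<^sup>2 + ?p m * (x (Suc m))\<^sup>2 + (\<Sum>i<Suc m. ?p i * (x (Suc i) - x i)\<^sup>2)"
  proof -
    \<comment> \<open>An interior diagonal entry is shared by the squares of the two adjacent differences; each
      boundary entry belongs half to a difference and half to a boundary term.\<close>
    have "(\<Sum>i<n. ?d i * (x i)\<^sup>2) = ?d 0 * (x 0)\<^sup>2 + (\<Sum>i<m. ?d (Suc i) * (x (Suc i))\<^sup>2) + ?d (Suc m) * (x (Suc m))\<^sup>2"
      unfolding n by (simp only: sum.lessThan_Suc_shift[of _ "Suc m"] sum.lessThan_Suc[of _ m] add.assoc)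
    also have "(\<Sum>i<m. ?d (Suc i) * (x (Suc i))\<^sup>2)
        = (\<Sum>i<m. ?p (Suc i) * (x (Suc i))\<^sup>2 + ?p i * (x (Suc i))\<^sup>2)"
      by (intro sum.cong refl) (auto simp: distrib_right)
    finally have diag: "(\<Sum>i<n. ?d i * (x i)\<^sup>2) = 2 * ?p 0 * (x 0)\<^sup>2 + 2 * ?p m * (x (Suc m))\<^sup>2
        + (\<Sum>i<m. ?p (Suc i) * (x (Suc i))\<^sup>2) + (\<Sum>i<m. ?p i * (x (Suc i))\<^sup>2)"
      by (simp add: sum.distrib)
    have "(\<Sum>i<Suc m. ?p i * (x (Suc i) - x i)\<^sup>2) = (\<Sum>i<Suc m. ?p i * (x (Suc i))\<^sup>2 + ?p i * (x i)\<^sup>2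
         - ?p i * (x (Suc i) * x i) - ?p i * (x (Suc i) * x i))"
      by (intro sum.cong refl) (simp add: power2_eq_square algebra_simps)
    then have square: "(\<Sum>i<Suc m. ?p i * (x (Suc i) - x i)\<^sup>2)
        = (\<Sum>i<Suc m. ?p i * (x (Suc i))\<^sup>2) + (\<Sum>i<Suc m. ?p i * (x i)\<^sup>2)
         - (\<Sum>i<Suc m. ?p i * (x (Suc i) * x i)) - (\<Sum>i<Suc m. ?p i * (x (Suc i) * x i))"
      by (simp only: sum.distrib sum_subtractf)
    have upper: "(\<Sum>i<Suc m. ?p i * (x (Suc i))\<^sup>2) = (\<Sum>i<m. ?p i * (x (Suc i))\<^sup>2) + ?p m * (x (Suc m))\<^sup>2"
      by (rule sum.lessThan_Suc)
    have lower: "(\<Sum>i<Suc m. ?p i * (x i)\<^sup>2) = ?p 0 * (x 0)\<^sup>2 + (\<Sum>i<m. ?p (Suc i) * (x (Suc i))\<^sup>2)"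
      by (rule sum.lessThan_Suc_shift)
    show ?thesis using diag square upper lower by linarith
  qed
  finally show ?thesis unfolding dirichlet_energy_def by (simp only: n) simp
qed

lemma midpoint_in_unit_interval:
  assumes "i < n - 1"
  shows "(real i + 3/2) * (1 / (real n + 1)) \<in> {0..1}"
  using assms by (auto simp: field_simps)

lemma dirichlet_energy_mono:
  assumes "\<And>t. t \<in> {0..1} \<Longrightarrow> a t \<le> b t" "2 \<le> n"
  shows "dirichlet_energy a n x \<le> dirichlet_energy b n x"
proof -
  have "midpoint_value a n i \<le> midpoint_value b n i" if "i < n - 1" for i
    using assms(1)[OF midpoint_in_unit_interval[OF that]] by (simp add: midpoint_value_def)
  with assms(2) show ?thesis unfolding dirichlet_energy_def
    by (intro mult_left_mono add_mono mult_right_mono sum_mono) auto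
qed

lemma dirichlet_energy_scale:
  "dirichlet_energy (\<lambda>t. c * a t) n x = c * dirichlet_energy a n x"
proof -
  have m: "midpoint_value (\<lambda>t. c * a t) n i = c * midpoint_value a n i" for i
    by (simp add: midpoint_value_def)
  show ?thesis
    unfolding dirichlet_energy_def m mult.assoc sum_distrib_left[symmetric] distrib_left[symmetric]
    by (simp add: mult.left_commute)
qed

text \<open>If the boundary term at \<open>0\<close> vanishes, then the first nonzero value of \<open>x\<close> follows a zero and
  produces a nonzero difference.\<close>

lemma dirichlet_energy_pos:
  assumes "\<And>t. t \<in> {0..1} \<Longrightarrow> 0 < a t" "2 \<le> n" "\<exists>i<n. x i \<noteq> 0"
  shows "0 < dirichlet_energy a n x"
proof -
  have p: "0 < midpoint_value a n i" if "i < n - 1" for i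
    using assms(1)[OF midpoint_in_unit_interval[OF that]] by (simp add: midpoint_value_def)
  define k where "k = (LEAST i. x i \<noteq> 0)"
  obtain i where i: "i < n" "x i \<noteq> 0" using assms(3) by auto
  have k: "x k \<noteq> 0" "k < n" "\<And>j. j < k \<Longrightarrow> x j = 0"
    using LeastI[of "\<lambda>i. x i \<noteq> 0", OF i(2)] Least_le[of "\<lambda>i. x i \<noteq> 0", OF i(2)] not_less_Least i(1)
    unfolding k_def by (auto intro: le_less_trans)
  have nn: "0 \<le> midpoint_value a n 0 * (x 0)\<^sup>2" "0 \<le> midpoint_value a n (n - 2) * (x (n - 1))\<^sup>2"
    "\<And>i. i \<in> {..<n - 1} \<Longrightarrow> 0 \<le> midpoint_value a n i * (x (Suc i) - x i)\<^sup>2"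
    using p[of 0] p[of "n - 2"] p assms(2) by (auto intro!: mult_nonneg_nonneg simp: less_imp_le)
  have "0 < midpoint_value a n 0 * (x 0)\<^sup>2 + midpoint_value a n (n - 2) * (x (n - 1))\<^sup>2
      + (\<Sum>i<n - 1. midpoint_value a n i * (x (Suc i) - x i)\<^sup>2)"
  proof (cases k)
    case 0
    then have "0 < midpoint_value a n 0 * (x 0)\<^sup>2" using k(1) p[of 0] assms(2) by simp
    with nn show ?thesis by (intro add_pos_nonneg sum_nonneg) auto
  next
    case (Suc j)
    then have "0 < midpoint_value a n j * (x (Suc j) - x j)\<^sup>2" "j \<in> {..<n - 1}"
      using k p[of j] by auto
    then have "0 < (\<Sum>i<n - 1. midpoint_value a n i * (x (Suc i) - x i)\<^sup>2)"
      using nn(3) by (intro sum_pos2) auto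
    with nn show ?thesis by (intro add_nonneg_pos) auto
  qed
  then show ?thesis by (simp add: dirichlet_energy_def)
qed

lemma dirichlet_energy_nonneg:
  assumes "\<And>t. t \<in> {0..1} \<Longrightarrow> 0 < a t" "2 \<le> n"
  shows "0 \<le> dirichlet_energy a n x"
  using dirichlet_energy_mono[of "\<lambda>_. 0" a n x] assms
  by (simp add: less_imp_le dirichlet_energy_def midpoint_value_def)

definition grid_size :: "nat \<Rightarrow> (nat \<Rightarrow> nat) \<Rightarrow> nat" where
  "grid_size d n = (if d = 2 then n 1 * n 2 else n 1 * n 2 * n 3)"

text \<open>The one-dimensional energies in direction \<open>l\<close>, summed over all grid lines in that direction. In
  three dimensions, the lines in the last direction are numbered by a single index below \<open>n 1 * n 2\<close>.\<close>

definition stiffness_energy :: "nat \<Rightarrow> (nat \<Rightarrow> real \<Rightarrow> real) \<Rightarrow> (nat \<Rightarrow> nat) \<Rightarrow> (nat \<Rightarrow> real) \<Rightarrow> real" where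
  "stiffness_energy d a n x =
    (if d = 2 then (\<Sum>k<n 2. dirichlet_energy (a 1) (n 1) (\<lambda>i. x (i * n 2 + k)))
        + (\<Sum>i<n 1. dirichlet_energy (a 2) (n 2) (\<lambda>k. x (i * n 2 + k)))
     else (\<Sum>l<n 3. \<Sum>k<n 2. dirichlet_energy (a 1) (n 1) (\<lambda>i. x ((i * n 2 + k) * n 3 + l)))
        + (\<Sum>l<n 3. \<Sum>i<n 1. dirichlet_energy (a 2) (n 2) (\<lambda>k. x ((i * n 2 + k) * n 3 + l)))
        + (\<Sum>i<n 1 * n 2. dirichlet_energy (a 3) (n 3) (\<lambda>l. x (i * n 3 + l))))"

lemma stiffness_symmetric:
  "stiffness d a n \<in> carrier_mat (grid_size d n) (grid_size d n)"
  "transpose_mat (stiffness d a n) = stiffness d a n"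
proof -
  note t = fd_matrix_transpose transpose_one
  note c = kronecker_carrier[OF fd_matrix_carrier one_carrier_mat] kronecker_carrier[OF one_carrier_mat fd_matrix_carrier]
  note s = kronecker_transpose[OF fd_matrix_carrier one_carrier_mat t] kronecker_transpose[OF one_carrier_mat fd_matrix_carrier t(2,1)]
  show "stiffness d a n \<in> carrier_mat (grid_size d n) (grid_size d n)"
    unfolding stiffness_def Let_def grid_size_def kronecker_one_one
    by (auto intro!: add_carrier_mat kronecker_carrier)
  show "transpose_mat (stiffness d a n) = stiffness d a n"
  proof (cases "d = 2")
    case True
    then show ?thesis unfolding stiffness_def Let_def
      by (simp add: transpose_add[OF c] s)
  next
    case False
    have "transpose_mat ((M + N) + L) = (M + N) + L"
      if "M \<in> carrier_mat k k" "N \<in> carrier_mat k k" "L \<in> carrier_mat k k"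
        "transpose_mat M = M" "transpose_mat N = N" "transpose_mat L = L" for M N L :: "real mat" and k
      using that by (simp add: transpose_add[of _ k k])
    from this[OF kronecker_carrier[OF c(1) one_carrier_mat] kronecker_carrier[OF c(2) one_carrier_mat]
        kronecker_carrier[OF one_carrier_mat fd_matrix_carrier]
        kronecker_transpose[OF c(1) one_carrier_mat s(1) transpose_one]
        kronecker_transpose[OF c(2) one_carrier_mat s(2) transpose_one]
        kronecker_transpose[OF one_carrier_mat fd_matrix_carrier t(2,1)]]
    show ?thesis using False unfolding stiffness_def Let_def kronecker_one_one by simp
  qed
qed

lemma qform_stiffness:
  assumes "d \<in> {2, 3}" "\<And>l. l \<in> {1..d} \<Longrightarrow> 2 \<le> n l"
  shows "qform (stiffness d a n) x = stiffness_energy d a n x"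
proof -
  have n: "2 \<le> n 1" "2 \<le> n 2" "d = 3 \<Longrightarrow> 2 \<le> n 3" using assms by auto
  note c = kronecker_carrier[OF fd_matrix_carrier one_carrier_mat] kronecker_carrier[OF one_carrier_mat fd_matrix_carrier]
  note q = qform_kronecker_one_right[OF fd_matrix_carrier] qform_kronecker_one_left[OF fd_matrix_carrier]
  show ?thesis
  proof (cases "d = 2")
    case True
    then show ?thesis
      using n by (simp add: stiffness_def Let_def stiffness_energy_def bform_add[OF c] q qform_fd_matrix)
  next
    case False
    then have d: "d = 3" using assms(1) by simp
    show ?thesis
      using n(1,2) n(3)[OF d] unfolding stiffness_def Let_def kronecker_one_one stiffness_energy_def
      by (simp add: d bform_add[OF add_carrier_mat kronecker_carrier[OF one_carrier_mat fd_matrix_carrier]]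
          bform_add[OF kronecker_carrier[OF c(1) one_carrier_mat] kronecker_carrier[OF c(2) one_carrier_mat]]
          kronecker_carrier[OF c(2) one_carrier_mat]
          qform_kronecker_one_right[OF c(1)] qform_kronecker_one_right[OF c(2)] q qform_fd_matrix)
  qed
qed

lemma stiffness_energy_mono:
  assumes "d \<in> {2, 3}" "\<And>l. l \<in> {1..d} \<Longrightarrow> 2 \<le> n l"
    and "\<And>l t. l \<in> {1..d} \<Longrightarrow> t \<in> {0..1} \<Longrightarrow> a l t \<le> b l t"
  shows "stiffness_energy d a n x \<le> stiffness_energy d b n x"
  using assms unfolding stiffness_energy_def
  by (auto intro!: add_mono sum_mono dirichlet_energy_mono)

lemma stiffness_energy_scale:
  "stiffness_energy d (\<lambda>l t. c * a l t) n x = c * stiffness_energy d a n x"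
  by (simp add: stiffness_energy_def dirichlet_energy_scale sum_distrib_left distrib_left)

lemma sum_dirichlet_energy_pos:
  assumes a: "\<And>t. t \<in> {0..1} \<Longrightarrow> 0 < a t" and n: "2 \<le> n" and x: "\<exists>i<N * n. x i \<noteq> 0"
  shows "0 < (\<Sum>i<N. dirichlet_energy a n (\<lambda>k. x (i * n + k)))"
proof -
  obtain j where j: "j < N * n" "x j \<noteq> 0" using x by auto
  have "0 < dirichlet_energy a n (\<lambda>k. x (j div n * n + k))"
    using n j(2) by (intro dirichlet_energy_pos[OF a n] exI[of _ "j mod n"]) auto
  moreover have "j div n < N" using j(1) by (rule less_mult_imp_div_less)
  ultimately show ?thesis
    using dirichlet_energy_nonneg[OF a n] by (intro sum_pos2[of _ "j div n"]) auto
qed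

text \<open>The grid lines in the last direction cover the whole grid, so the energy in this direction is
  already positive; the other directions contribute nonnegative terms.\<close>

lemma pos_def_stiffness:
  assumes d: "d \<in> {2, 3}" and n: "\<And>l. l \<in> {1..d} \<Longrightarrow> 2 \<le> n l"
    and a: "\<And>l t. l \<in> {1..d} \<Longrightarrow> t \<in> {0..1} \<Longrightarrow> 0 < a l t"
  shows "pos_def (grid_size d n) (stiffness d a n)"
proof -
  have nonneg: "0 \<le> dirichlet_energy (a l) (n l) y" if "l \<in> {1..d}" for l y
    using dirichlet_energy_nonneg a n that by blast
  have "0 < stiffness_energy d a n x" if x: "\<exists>i<grid_size d n. x i \<noteq> 0" for x
  proof (cases "d = 2")
    case True
    then have "0 < (\<Sum>i<n 1. dirichlet_energy (a 2) (n 2) (\<lambda>k. x (i * n 2 + k)))"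
      using x a n by (intro sum_dirichlet_energy_pos) (auto simp: grid_size_def)
    moreover have "0 \<le> (\<Sum>k<n 2. dirichlet_energy (a 1) (n 1) (\<lambda>i. x (i * n 2 + k)))"
      using True by (intro sum_nonneg nonneg) auto
    ultimately show ?thesis using True by (simp add: stiffness_energy_def)
  next
    case False
    then have d3: "d = 3" using d by simp
    then have "0 < (\<Sum>i<n 1 * n 2. dirichlet_energy (a 3) (n 3) (\<lambda>l. x (i * n 3 + l)))"
      using x a n by (intro sum_dirichlet_energy_pos) (auto simp: grid_size_def)
    moreover have "0 \<le> (\<Sum>l<n 3. \<Sum>k<n 2. dirichlet_energy (a 1) (n 1) (\<lambda>i. x ((i * n 2 + k) * n 3 + l)))"
      "0 \<le> (\<Sum>l<n 3. \<Sum>i<n 1. dirichlet_energy (a 2) (n 2) (\<lambda>k. x ((i * n 2 + k) * n 3 + l)))"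
      using d3 by (intro sum_nonneg nonneg; simp)+
    ultimately show ?thesis using d3 by (simp add: stiffness_energy_def)
  qed
  then show ?thesis
    using stiffness_symmetric qform_stiffness[OF d n] by (simp add: pos_def_def)
qed

section \<open>The uniform bound\<close>

text \<open>For a single index the best $q$ is $(M - m) / (M + m)$, the relative distance of $m$ and $M$ from
  their midpoint. Including $1/2$ in the maximum keeps $q$ positive when $m = M$ throughout.\<close>

lemma relative_deviation_bound:
  fixes m M :: "nat \<Rightarrow> real"
  assumes "finite K" "\<And>l. l \<in> K \<Longrightarrow> 0 < m l \<and> m l \<le> M l"
  obtains q where "0 < q" "q < 1"
    "\<And>l. l \<in> K \<Longrightarrow> (1 - q) * ((M l + m l) / 2) \<le> m l \<and> M l \<le> (1 + q) * ((M l + m l) / 2)"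
proof -
  let ?r = "\<lambda>l. (M l - m l) / (M l + m l)"
  define q where "q = Max (insert (1/2) (?r ` K))"
  have fin: "finite (insert (1/2) (?r ` K))" using assms(1) by simp
  have "q \<in> insert (1/2) (?r ` K)" unfolding q_def using fin by (intro Max_in) auto
  moreover have "?r l < 1" if "l \<in> K" for l using assms(2)[OF that] by simp
  ultimately have "q < 1" by auto
  moreover have "1/2 \<le> q" unfolding q_def using fin by (intro Max_ge) auto
  moreover have "(1 - q) * ((M l + m l) / 2) \<le> m l \<and> M l \<le> (1 + q) * ((M l + m l) / 2)" if "l \<in> K" for l
  proof -
    have "?r l \<le> q" unfolding q_def using fin that by (intro Max_ge) auto
    then have "M l - m l \<le> q * (M l + m l)" using assms(2)[OF that] by (simp add: field_simps)
    then show ?thesis by (simp add: field_simps)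
  qed
  ultimately show thesis by (intro that[of q]) auto
qed

theorem theorem3p2:
  fixes d :: nat and \<alpha> \<beta> \<gamma> :: real
    and a a_min a_maj :: "nat \<Rightarrow> real \<Rightarrow> real" and b0 :: "nat \<Rightarrow> real"
  assumes "d \<in> {2, 3}"
    and "0 \<le> \<alpha>" and "\<alpha> \<le> 1" and "\<beta> > 0" and "\<gamma> > 0"
    and "\<And>l x. l \<in> {1..d} \<Longrightarrow> x \<in> {0..1} \<Longrightarrow>
           0 < a_min l x \<and> a_min l x \<le> a l x \<and> a l x \<le> a_maj l x"
    and "\<And>l. l \<in> {1..d} \<Longrightarrow> \<exists>x\<in>{0..1}. \<forall>y\<in>{0..1}. a_min l x \<le> a_min l y"
    and "\<And>l. l \<in> {1..d} \<Longrightarrow> \<exists>x\<in>{0..1}. \<forall>y\<in>{0..1}. a_maj l y \<le> a_maj l x"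
    and "\<And>l. l \<in> {1..d} \<Longrightarrow>
           b0 l = 1/2 * ((SUP x\<in>{0..1}. a_maj l x) + (INF x\<in>{0..1}. a_min l x))"
  shows "\<exists>C q :: real. C > 0 \<and> 0 < q \<and> q < 1 \<and>
    (\<forall>n :: nat \<Rightarrow> nat. (\<forall>l\<in>{1..d}. n l \<ge> 2) \<longrightarrow>
      (let A = stiffness d a n;
           B = stiffness d (\<lambda>l x. b0 l) n;
           B\<^sub>0 = F2 \<alpha> \<beta> \<gamma> B
       in spectral_cond (the (mat_inverse B\<^sub>0) * F2 \<alpha> \<beta> \<gamma> A)
          \<le> C * (max ((1 + q) powr \<alpha>) ((1 - q) powr (- \<alpha>)) /
                 min ((1 + q) powr (- \<alpha>)) ((1 - q) powr \<alpha>))))"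
proof -
  define m where "m = (\<lambda>l. INF x\<in>{0..1}. a_min l x)"
  define M where "M = (\<lambda>l. SUP x\<in>{0..1}. a_maj l x)"
  have mM: "0 < m l \<and> (\<forall>x\<in>{0..1}. m l \<le> a l x \<and> a l x \<le> M l)" if l: "l \<in> {1..d}" for l
  proof -
    obtain u where u: "u \<in> {0..1}" "\<forall>y\<in>{0..1}. a_min l u \<le> a_min l y" using assms(7)[OF l] by blast
    obtain v where v: "v \<in> {0..1}" "\<forall>y\<in>{0..1}. a_maj l y \<le> a_maj l v" using assms(8)[OF l] by blast
    have "m l = a_min l u" unfolding m_def using u by (intro cInf_eq_minimum) auto
    moreover have "M l = a_maj l v" unfolding M_def using v by (intro cSup_eq_maximum) auto
    moreover have "a_min l u \<le> a l x \<and> a l x \<le> a_maj l v" if "x \<in> {0..1}" for x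
      using assms(6)[OF l that] u(2) v(2) that by force
    ultimately show ?thesis using assms(6)[OF l u(1)] by simp
  qed
  have b0: "b0 l = (M l + m l) / 2" if "l \<in> {1..d}" for l
    using assms(9)[OF that] by (simp add: m_def M_def)
  have le: "0 < m l \<and> m l \<le> M l" if "l \<in> {1..d}" for l
    using mM[OF that] by (meson atLeastAtMost_iff order_refl order_trans zero_le_one)
  have a_pos: "0 < a l x" if "l \<in> {1..d}" "x \<in> {0..1}" for l x
    using assms(6)[OF that] by linarith
  have b0_pos: "0 < b0 l" if "l \<in> {1..d}" for l
    using le[OF that] b0[OF that] by simp
  obtain q where q: "0 < q" "q < 1"
    and near': "\<And>l. l \<in> {1..d} \<Longrightarrow> (1 - q) * ((M l + m l) / 2) \<le> m l \<and> M l \<le> (1 + q) * ((M l + m l) / 2)"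
    by (rule relative_deviation_bound[of "{1..d}" m M]) (use le in auto)
  have near: "(1 - q) * b0 l \<le> a l x" "a l x \<le> (1 + q) * b0 l"
    if "l \<in> {1..d}" "x \<in> {0..1}" for l x
    using near'[OF that(1)] mM[OF that(1)] that(2) unfolding b0[OF that(1)] by force+
  have "spectral_cond (the (mat_inverse (F2 \<alpha> \<beta> \<gamma> (stiffness d (\<lambda>l x. b0 l) n))) * F2 \<alpha> \<beta> \<gamma> (stiffness d a n))
      \<le> 1 * (max ((1 + q) powr \<alpha>) ((1 - q) powr (- \<alpha>)) / min ((1 + q) powr (- \<alpha>)) ((1 - q) powr \<alpha>))"
    if n: "\<forall>l\<in>{1..d}. 2 \<le> n l" for n
  proof -
    have n': "2 \<le> n l" if "l \<in> {1..d}" for l using n that by simp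
    have qf: "qform (stiffness d c n) x = stiffness_energy d c n x" for c x
      using assms(1) n' by (rule qform_stiffness)
    have A: "pos_def (grid_size d n) (stiffness d a n)"
      using a_pos by (intro pos_def_stiffness[OF assms(1) n'])
    have B: "pos_def (grid_size d n) (stiffness d (\<lambda>l x. b0 l) n)"
      using b0_pos by (intro pos_def_stiffness[OF assms(1) n'])
    have N: "0 < grid_size d n"
      using n'[of 1] n'[of 2] n'[of 3] assms(1) by (auto simp: grid_size_def)
    have lower: "(1 - q) * qform (stiffness d (\<lambda>l x. b0 l) n) x \<le> qform (stiffness d a n) x" for x
      unfolding qf stiffness_energy_scale[symmetric]
      by (rule stiffness_energy_mono) (use assms(1) n' near in auto)
    have upper: "qform (stiffness d a n) x \<le> (1 + q) * qform (stiffness d (\<lambda>l x. b0 l) n) x" for x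
      unfolding qf stiffness_energy_scale[symmetric]
      by (rule stiffness_energy_mono) (use assms(1) n' near in auto)
    show ?thesis
      using spectral_cond_F2_le[OF A B N assms(2-5) q lower upper] by simp
  qed
  then show ?thesis
    using q unfolding Let_def by (intro exI[of _ 1] exI[of _ q]) auto
qed

end
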